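(* Let $\mathbb{K}$ be an algebraically closed field of characteristic zero and let $X$ be an affine toric variety over $\mathbb{K}$ (not necessarily normal), with acting torus $T$. Then: (a) $\mathrm{ML}_h(\mathbb{K}[X]) = \mathrm{ML}(\mathbb{K}[X])$; (b) if the algebra $\mathbb{K}[X]$ admits a locally nilpotent derivation with a slice, then $$\mathrm{ML}_h(\mathbb{K}[X]) = \mathrm{ML}(\mathbb{K}[X]) = \mathrm{ML}^*(\mathbb{K}[X]).$$
   Context: An irreducible algebraic variety $X$ over $\mathbb{K}$ is called toric if an algebraic torus $T\cong(\mathbb{K}^\times)^n$ acts algebraically on $X$ with an open orbit; normality of $X$ is not assumed, and the action may be assumed effective. The algebra of regular functions $\mathbb{K}[X]$ is then naturally graded by the character group $\mathfrak{X}(T)$ of $T$. For an affine $\mathbb{K}$-domain $B$, a $\mathbb{K}$-derivation $D$ of $B$ is locally nilpotent if for every $f\in B$ there is a positive integer $n$ with $D^n(f)=0$. $\mathrm{LND}(B)$ is the set of locally nilpotent $\mathbb{K}$-derivations of $B$. A slice of $D\in\mathrm{LND}(B)$ is an element $s\in B$ with $D(s)=1$; $\mathrm{LND}^*(B)$ is the set of $D\in\mathrm{LND}(B)$ that have a slice. Define $$\mathrm{ML}(B)=\bigcap_{D\in\mathrm{LND}(B)}\operatorname{Ker}D,\qquad \mathrm{ML}^*(B)=\bigcap_{D\in\mathrm{LND}^*(B)}\operatorname{Ker}D.$$ For $B=\mathbb{K}[X]$ with $X$ affine toric, $\mathrm{LND}_h(B)$ is the set of those $D\in\mathrm{LND}(B)$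 that are homogeneous with respect to the $\mathfrak{X}(T)$-grading, i.e. there is a degree $g_0$ such that $D(B_g)\subset B_{g+g_0}$ for all $g$; and $\mathrm{ML}_h(B)=\bigcap_{D\in\mathrm{LND}_h(B)}\operatorname{Ker}D$. *)

theory Defs
  imports
    "HOL-Computational_Algebra.Polynomial"
    "HOL-Algebra.AbelCoset"
    "HOL-Algebra.Module"
    "HOL-Algebra.Product_Groups"
    "HOL-Algebra.Group_Action"
begin

section \<open>Locally nilpotent derivations of an algebra over a field\<close>

text \<open>The scalars are all elements of the ground field type 'k.  Derivations are extensional, so
  that a derivation is literally a map defined on the carrier only.\<close>

definition derivations :: "('k, 'b, 'm) module_scheme \<Rightarrow> ('b \<Rightarrow> 'b) set" where
  "derivations B =
     {D \<in> carrier B \<rightarrow>\<^sub>E carrier B.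
        (\<forall>f\<in>carrier B. \<forall>g\<in>carrier B. D (f \<oplus>\<^bsub>B\<^esub> g) = D f \<oplus>\<^bsub>B\<^esub> D g) \<and>
        (\<forall>c. \<forall>f\<in>carrier B. D (c \<odot>\<^bsub>B\<^esub> f) = c \<odot>\<^bsub>B\<^esub> D f) \<and>
        (\<forall>f\<in>carrier B. \<forall>g\<in>carrier B.
           D (f \<otimes>\<^bsub>B\<^esub> g) = (D f \<otimes>\<^bsub>B\<^esub> g) \<oplus>\<^bsub>B\<^esub> (f \<otimes>\<^bsub>B\<^esub> D g))}"

definition LND :: "('k, 'b, 'm) module_scheme \<Rightarrow> ('b \<Rightarrow> 'b) set" where
  "LND B = {D \<in> derivations B. \<forall>f\<in>carrier B. \<exists>k>0. (D ^^ k) f = \<zero>\<^bsub>B\<^esub>}"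

definition LND_star :: "('k, 'b, 'm) module_scheme \<Rightarrow> ('b \<Rightarrow> 'b) set" where
  "LND_star B = {D \<in> LND B. \<exists>s\<in>carrier B. D s = \<one>\<^bsub>B\<^esub>}"

text \<open>The intersection is taken inside the algebra: for an empty family it is the whole algebra.\<close>

definition common_kernel :: "('k, 'b, 'm) module_scheme \<Rightarrow> ('b \<Rightarrow> 'b) set \<Rightarrow> 'b set" where
  "common_kernel B \<D> = carrier B \<inter> (\<Inter>D\<in>\<D>. a_kernel B B D)"

definition makar_limanov :: "('k, 'b, 'm) module_scheme \<Rightarrow> 'b set" where
  "makar_limanov B = common_kernel B (LND B)"

definition makar_limanov_star :: "('k, 'b, 'm) module_scheme \<Rightarrow> 'b set" where
  "makar_limanov_star B = common_kernel B (LND_star B)"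


section \<open>Affine varieties as closed subsets of affine space\<close>

inductive_set generated_functions :: "('a \<Rightarrow> 'k::comm_ring_1) set \<Rightarrow> ('a \<Rightarrow> 'k) set"
  for G :: "('a \<Rightarrow> 'k) set" where
  gen: "g \<in> G \<Longrightarrow> g \<in> generated_functions G"
| const: "(\<lambda>_. c) \<in> generated_functions G"
| add: "f \<in> generated_functions G \<Longrightarrow> g \<in> generated_functions G \<Longrightarrow>
    (\<lambda>x. f x + g x) \<in> generated_functions G"
| mult: "f \<in> generated_functions G \<Longrightarrow> g \<in> generated_functions G \<Longrightarrow>
    (\<lambda>x. f x * g x) \<in> generated_functions G"

definition affine_space :: "nat \<Rightarrow> (nat \<Rightarrow> 'k) set" where
  "affine_space m = {..<m} \<rightarrow>\<^sub>E UNIV"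

definition polynomial_functions :: "nat \<Rightarrow> ((nat \<Rightarrow> 'k::comm_ring_1) \<Rightarrow> 'k) set" where
  "polynomial_functions m = generated_functions {\<lambda>x. x j | j. j < m}"

definition zariski_closed :: "nat \<Rightarrow> (nat \<Rightarrow> 'k::field) set \<Rightarrow> bool" where
  "zariski_closed m Z \<longleftrightarrow>
     (\<exists>S\<subseteq>polynomial_functions m. Z = {x \<in> affine_space m. \<forall>p\<in>S. p x = 0})"

definition irreducible_affine_variety :: "nat \<Rightarrow> (nat \<Rightarrow> 'k::field) set \<Rightarrow> bool" where
  "irreducible_affine_variety m X \<longleftrightarrow>
     zariski_closed m X \<and> X \<noteq> {} \<and>
     (\<forall>Y Z. zariski_closed m Y \<and> zariski_closed m Z \<and> X \<subseteq> Y \<union> Z \<longrightarrow> X \<subseteq> Y \<or> X \<subseteq> Z)"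

definition open_in_variety :: "nat \<Rightarrow> (nat \<Rightarrow> 'k::field) set \<Rightarrow> (nat \<Rightarrow> 'k) set \<Rightarrow> bool" where
  "open_in_variety m X U \<longleftrightarrow> (\<exists>Z. zariski_closed m Z \<and> U = X - Z)"

text \<open>A regular function on X is represented by its extension by zero outside X; in particular the
  unit element is the indicator function of X.\<close>

definition regular_functions ::
    "nat \<Rightarrow> (nat \<Rightarrow> 'k::field) set \<Rightarrow> ('k, (nat \<Rightarrow> 'k) \<Rightarrow> 'k) module" where
  "regular_functions m X =
     \<lparr>carrier = {(\<lambda>x. if x \<in> X then p x else 0) | p. p \<in> polynomial_functions m},
      monoid.mult = (\<lambda>f g x. f x * g x),
      one = (\<lambda>x. if x \<in> X then 1 else 0),
      zero = (\<lambda>x. 0),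
      add = (\<lambda>f g x. f x + g x),
      module.smult = (\<lambda>c f x. c * f x)\<rparr>"


section \<open>Algebraic tori and toric varieties\<close>

definition multiplicative_group :: "'k::field monoid" where
  "multiplicative_group = \<lparr>carrier = UNIV - {0}, monoid.mult = (*), one = 1\<rparr>"

definition torus :: "nat \<Rightarrow> (nat \<Rightarrow> 'k::field) monoid" where
  "torus n = product_group {..<n} (\<lambda>_. multiplicative_group)"

definition torus_functions :: "nat \<Rightarrow> ((nat \<Rightarrow> 'k::field) \<Rightarrow> 'k) set" where
  "torus_functions n =
     generated_functions ({\<lambda>t. t i | i. i < n} \<union> {\<lambda>t. inverse (t i) | i. i < n})"

text \<open>The regular functions on the product of the torus and affine space.\<close>

definition torus_affine_functions ::
    "nat \<Rightarrow> nat \<Rightarrow> ((nat \<Rightarrow> 'k::field) \<times> (nat \<Rightarrow> 'k) \<Rightarrow> 'k) set" where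
  "torus_affine_functions n m =
     generated_functions
       ({\<lambda>(t, x). t i | i. i < n} \<union> {\<lambda>(t, x). inverse (t i) | i. i < n} \<union> {\<lambda>(t, x). x j | j. j < m})"

definition algebraic_torus_action ::
    "nat \<Rightarrow> nat \<Rightarrow> (nat \<Rightarrow> 'k::field) set \<Rightarrow> ((nat \<Rightarrow> 'k) \<Rightarrow> (nat \<Rightarrow> 'k) \<Rightarrow> (nat \<Rightarrow> 'k)) \<Rightarrow> bool" where
  "algebraic_torus_action n m X \<phi> \<longleftrightarrow>
     group_action (torus n) X \<phi> \<and>
     (\<forall>j<m. \<exists>F\<in>torus_affine_functions n m.
        \<forall>t\<in>carrier (torus n). \<forall>x\<in>X. \<phi> t x j = F (t, x))"

definition affine_toric_variety ::
    "nat \<Rightarrow> nat \<Rightarrow> (nat \<Rightarrow> 'k::field) set \<Rightarrow> ((nat \<Rightarrow> 'k) \<Rightarrow> (nat \<Rightarrow> 'k) \<Rightarrow> (nat \<Rightarrow> 'k)) \<Rightarrow> bool" where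
  "affine_toric_variety n m X \<phi> \<longleftrightarrow>
     irreducible_affine_variety m X \<and>
     algebraic_torus_action n m X \<phi> \<and>
     (\<exists>x\<in>X. open_in_variety m X (orbit (torus n) \<phi> x))"


section \<open>The grading by characters and homogeneous derivations\<close>

definition character_group :: "nat \<Rightarrow> ((nat \<Rightarrow> 'k::field) \<Rightarrow> 'k) monoid" where
  "character_group n =
     \<lparr>carrier = {\<chi> \<in> hom (torus n) multiplicative_group \<inter> extensional (carrier (torus n)).
                   \<exists>F\<in>torus_functions n. \<forall>t\<in>carrier (torus n). \<chi> t = F t},
      monoid.mult = (\<lambda>\<chi> \<psi>. \<lambda>t\<in>carrier (torus n). \<chi> t * \<psi> t),
      one = (\<lambda>t\<in>carrier (torus n). 1)\<rparr>"

text \<open>With the other usual convention, letting t act on f through the inverse of t, the component of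
  a character becomes that of its inverse; the homogeneous derivations are the same.\<close>

definition graded_component ::
    "nat \<Rightarrow> nat \<Rightarrow> (nat \<Rightarrow> 'k::field) set \<Rightarrow> ((nat \<Rightarrow> 'k) \<Rightarrow> (nat \<Rightarrow> 'k) \<Rightarrow> (nat \<Rightarrow> 'k)) \<Rightarrow>
      ((nat \<Rightarrow> 'k) \<Rightarrow> 'k) \<Rightarrow> ((nat \<Rightarrow> 'k) \<Rightarrow> 'k) set" where
  "graded_component n m X \<phi> \<chi> =
     {f \<in> carrier (regular_functions m X).
        \<forall>t\<in>carrier (torus n). \<forall>x\<in>X. f (\<phi> t x) = \<chi> t * f x}"

definition LND_h ::
    "nat \<Rightarrow> nat \<Rightarrow> (nat \<Rightarrow> 'k::field) set \<Rightarrow> ((nat \<Rightarrow> 'k) \<Rightarrow> (nat \<Rightarrow> 'k) \<Rightarrow> (nat \<Rightarrow> 'k)) \<Rightarrow>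
      (((nat \<Rightarrow> 'k) \<Rightarrow> 'k) \<Rightarrow> ((nat \<Rightarrow> 'k) \<Rightarrow> 'k)) set" where
  "LND_h n m X \<phi> =
     {D \<in> LND (regular_functions m X).
        \<exists>\<chi>\<^sub>0\<in>carrier (character_group n). \<forall>\<chi>\<in>carrier (character_group n).
          D ` graded_component n m X \<phi> \<chi> \<subseteq> graded_component n m X \<phi> (\<chi> \<otimes>\<^bsub>character_group n\<^esub> \<chi>\<^sub>0)}"

definition makar_limanov_h ::
    "nat \<Rightarrow> nat \<Rightarrow> (nat \<Rightarrow> 'k::field) set \<Rightarrow> ((nat \<Rightarrow> 'k) \<Rightarrow> (nat \<Rightarrow> 'k) \<Rightarrow> (nat \<Rightarrow> 'k)) \<Rightarrow>
      ((nat \<Rightarrow> 'k) \<Rightarrow> 'k) set" where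
  "makar_limanov_h n m X \<phi> = common_kernel (regular_functions m X) (LND_h n m X \<phi>)"

end

theory Submission
  imports Defs "HOL-Library.Function_Algebras"
begin

text \<open>The algebra \<open>B\<close> of regular functions is a domain graded by the characters, with components of
  dimension at most one because the orbit is dense.

  (a) Let \<open>D\<close> be a locally nilpotent derivation and \<open>f\<close> homogeneous with \<open>D f \<noteq> 0\<close>. If a component
  \<open>D\<^sub>e\<close> of \<open>D\<close> is not locally nilpotent, then no \<open>D\<^sub>e\<^sup>j a\<close> vanishes for some homogeneous \<open>a\<close>, and since
  components are lines, \<open>a (D\<^sub>e f)\<^sup>j\<close> is divisible by \<open>f\<^sup>j\<close> for all \<open>j\<close>. If this held for all \<open>e\<close> with
  \<open>D\<^sub>e f \<noteq> 0\<close>, then \<open>h (D f)\<^sup>j\<close> would be divisible by \<open>f\<^sup>j\<close> for some \<open>h \<noteq> 0\<close> and all \<open>j\<close>, which is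
  impossible because \<open>D f\<close> has smaller \<open>D\<close>-degree than \<open>f\<close>. So some locally nilpotent \<open>D\<^sub>e\<close> does not
  kill \<open>f\<close>.

  (b) A similar degree argument turns a slice into a homogeneous derivation \<open>d\<close> with a homogeneous
  slice \<open>s\<close>. If \<open>D\<close> is a homogeneous locally nilpotent derivation with \<open>D f \<noteq> 0\<close> and \<open>d f = 0\<close>, then for
  a fixed \<open>k\<close> the derivation \<open>s\<^sup>-\<^sup>k (D + (s\<^sup>k - D s) d)\<close> maps \<open>B\<close> to itself, is locally nilpotent with
  slice \<open>s\<close>, and does not kill \<open>f\<close>.\<close>

section \<open>Locally nilpotent derivations of a domain\<close>

text \<open>The unit \<open>u\<close> need not be the unit of the ambient ring: for functions extended by zero outside \<open>X\<close>
  it is the indicator function of \<open>X\<close>. Since \<open>1 \<notin> B\<close> then, powers occur only as factors \<open>s ^ k * b\<close>.\<close>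

locale scalar_domain =
  fixes B :: "'b::comm_ring_1 set" and u :: 'b and \<iota> :: "'k::field_char_0 \<Rightarrow> 'b"
  assumes unit_closed: "u \<in> B"
    and unit_mult: "b \<in> B \<Longrightarrow> u * b = b"
    and unit_nonzero: "u \<noteq> 0"
    and add_closed: "a \<in> B \<Longrightarrow> b \<in> B \<Longrightarrow> a + b \<in> B"
    and mult_closed: "a \<in> B \<Longrightarrow> b \<in> B \<Longrightarrow> a * b \<in> B"
    and scale_closed: "b \<in> B \<Longrightarrow> \<iota> c * b \<in> B"
    and scalar_add: "\<iota> (c + d) = \<iota> c + \<iota> d"
    and scalar_mult: "\<iota> (c * d) = \<iota> c * \<iota> d"
    and scalar_one: "\<iota> 1 = 1"
    and no_zero_divisors: "a \<in> B \<Longrightarrow> b \<in> B \<Longrightarrow> a * b = 0 \<Longrightarrow> a = 0 \<or> b = 0"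
begin

lemma scalar_zero: "\<iota> 0 = 0"
  using scalar_add[of 0 0] by simp

lemma scalar_minus: "\<iota> (- c) = - \<iota> c"
  using scalar_add[of c "- c"] scalar_zero by (simp add: eq_neg_iff_add_eq_0 add.commute)

lemma scalar_of_nat: "\<iota> (of_nat n) = of_nat n"
  by (induction n) (auto simp: scalar_zero scalar_add scalar_one)

lemma zero_closed: "0 \<in> B"
  using scale_closed[OF unit_closed, of 0] by (simp add: scalar_zero)

lemma minus_closed: "b \<in> B \<Longrightarrow> - b \<in> B"
  using scale_closed[of b "- 1"] by (simp add: scalar_minus scalar_one)

lemma diff_closed: "a \<in> B \<Longrightarrow> b \<in> B \<Longrightarrow> a - b \<in> B"
  using add_closed[of a "- b"] minus_closed by simp

lemma power_mult_closed: "a \<in> B \<Longrightarrow> b \<in> B \<Longrightarrow> a ^ j * b \<in> B"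
  by (induction j) (auto simp: mult.assoc mult_closed)

lemma sum_closed: "(\<And>i. i \<in> I \<Longrightarrow> f i \<in> B) \<Longrightarrow> sum f I \<in> B"
  by (induction I rule: infinite_finite_induct) (auto simp: zero_closed add_closed)

lemma of_nat_mult_closed: "b \<in> B \<Longrightarrow> of_nat n * b \<in> B"
  using scale_closed[of b "of_nat n"] by (simp add: scalar_of_nat)

lemma scale_cancel: fixes b :: 'b shows "c \<noteq> 0 \<Longrightarrow> \<iota> (inverse c) * (\<iota> c * b) = b"
  by (metis left_inverse mult.assoc mult_1 scalar_mult scalar_one)

lemma scale_eq_zero: fixes b :: 'b shows "\<iota> c * b = 0 \<Longrightarrow> c = 0 \<or> b = 0"
  using scale_cancel[of c b] by auto

lemma of_nat_mult_eq_zero: fixes b :: 'b shows "of_nat n * b = 0 \<Longrightarrow> n = 0 \<or> b = 0"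
  using scale_eq_zero[of "of_nat n" b] by (simp add: scalar_of_nat)

lemma mult_nonzero: "a \<in> B \<Longrightarrow> b \<in> B \<Longrightarrow> a \<noteq> 0 \<Longrightarrow> b \<noteq> 0 \<Longrightarrow> a * b \<noteq> 0"
  using no_zero_divisors by blast

lemma power_mult_nonzero: "a \<in> B \<Longrightarrow> b \<in> B \<Longrightarrow> a \<noteq> 0 \<Longrightarrow> b \<noteq> 0 \<Longrightarrow> a ^ j * b \<noteq> 0"
  by (induction j) (auto simp: mult.assoc mult_nonzero power_mult_closed)

text \<open>Replaces division by \<open>s ^ k\<close> in a fraction field; the well-definedness of
  \<open>twist\<close> rests on it.\<close>

lemma power_mult_cancel:
  assumes "s \<in> B" "s \<noteq> 0" "a \<in> B" "b \<in> B" "s ^ k * a = s ^ k * b"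
  shows "a = b"
proof -
  have "s ^ k * (a - b) = 0"
    using assms by (simp add: algebra_simps)
  then show ?thesis
    using power_mult_nonzero[OF assms(1) diff_closed[OF assms(3,4)] assms(2)] by auto
qed

text \<open>Only the values on \<open>B\<close> are constrained, so maps can be constructed without
  care for what happens outside \<open>B\<close>; extensionality is restored at the end by
  \<open>restrict\<close>.\<close>

definition derivation :: "('b \<Rightarrow> 'b) \<Rightarrow> bool" where
  "derivation D \<longleftrightarrow>
     (\<forall>a\<in>B. D a \<in> B) \<and>
     (\<forall>a\<in>B. \<forall>b\<in>B. D (a + b) = D a + D b) \<and>
     (\<forall>c. \<forall>a\<in>B. D (\<iota> c * a) = \<iota> c * D a) \<and>
     (\<forall>a\<in>B. \<forall>b\<in>B. D (a * b) = D a * b + a * D b)"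

definition lnd :: "('b \<Rightarrow> 'b) \<Rightarrow> bool" where
  "lnd D \<longleftrightarrow> derivation D \<and> (\<forall>a\<in>B. \<exists>k. (D ^^ k) a = 0)"

lemma derivation_closed: "derivation D \<Longrightarrow> a \<in> B \<Longrightarrow> D a \<in> B"
  and derivation_add: "derivation D \<Longrightarrow> a \<in> B \<Longrightarrow> b \<in> B \<Longrightarrow> D (a + b) = D a + D b"
  and derivation_scale: "derivation D \<Longrightarrow> a \<in> B \<Longrightarrow> D (\<iota> c * a) = \<iota> c * D a"
  and derivation_mult: "derivation D \<Longrightarrow> a \<in> B \<Longrightarrow> b \<in> B \<Longrightarrow> D (a * b) = D a * b + a * D b"
  by (auto simp: derivation_def)

lemma lnd_derivation: "lnd D \<Longrightarrow> derivation D"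
  by (simp add: lnd_def)

lemma derivation_zero: "derivation D \<Longrightarrow> D 0 = 0"
  using derivation_add[of D 0 0] zero_closed by simp

lemma derivation_unit: "derivation D \<Longrightarrow> D u = 0"
  using derivation_mult[of D u u] unit_closed unit_mult[of u] unit_mult[of "D u"]
  by (simp add: derivation_closed mult.commute)

lemma derivation_sum:
  assumes "derivation D" "\<And>i. i \<in> I \<Longrightarrow> f i \<in> B"
  shows "D (sum f I) = (\<Sum>i\<in>I. D (f i))"
  using assms(2)
proof (induction I rule: infinite_finite_induct)
  case (insert i I)
  then show ?case
    by (simp add: derivation_add[OF assms(1)] sum_closed)
qed (auto simp: derivation_zero assms(1))

lemma derivation_power_mult:
  assumes "derivation D" "s \<in> B" "a \<in> B" "D s = 0"
  shows "D (s ^ i * a) = s ^ i * D a"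
  using assms
  by (induction i) (auto simp: mult.assoc derivation_mult power_mult_closed)

section \<open>Iterates of a derivation\<close>

lemma funpow_closed: "derivation D \<Longrightarrow> a \<in> B \<Longrightarrow> (D ^^ k) a \<in> B"
  by (induction k) (auto simp: derivation_closed)

lemma derivation_funpow_add: "derivation D \<Longrightarrow> a \<in> B \<Longrightarrow> b \<in> B \<Longrightarrow> (D ^^ k) (a + b) = (D ^^ k) a + (D ^^ k) b"
  by (induction k) (auto simp: derivation_add funpow_closed)

lemma funpow_scale: "derivation D \<Longrightarrow> a \<in> B \<Longrightarrow> (D ^^ k) (\<iota> c * a) = \<iota> c * (D ^^ k) a"
  by (induction k) (auto simp: derivation_scale funpow_closed)

lemma funpow_zero: "derivation D \<Longrightarrow> (D ^^ k) 0 = 0"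
  by (induction k) (auto simp: derivation_zero)

lemma funpow_eq_zero_mono:
  assumes "derivation D" "(D ^^ k) a = 0" "k \<le> l"
  shows "(D ^^ l) a = 0"
proof -
  have "(D ^^ (l - k + k)) a = 0"
    unfolding funpow_add comp_apply using assms by (simp add: funpow_zero)
  then show ?thesis using assms(3) by simp
qed

text \<open>In the Leibniz expansion of the iterate, every term with more than \<open>p\<close>
  derivatives on \<open>a\<close> or more than \<open>q\<close> on \<open>b\<close> vanishes, which
  leaves a single one. The induction on \<open>p + q\<close> applies \<open>D\<close> once to the
  product and treats the two resulting terms separately.\<close>

lemma funpow_mult_top:
  assumes D: "derivation D"
  shows "a \<in> B \<Longrightarrow> b \<in> B \<Longrightarrow> (D ^^ Suc p) a = 0 \<Longrightarrow> (D ^^ Suc q) b = 0 \<Longrightarrow>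
    (D ^^ (p + q)) (a * b) = of_nat ((p + q) choose p) * ((D ^^ p) a * (D ^^ q) b)"
proof (induction "p + q" arbitrary: p q a b)
  case 0
  then show ?case by simp
next
  case (Suc n)
  note mem = Suc.prems(1,2)
  have Dab: "D a \<in> B" "D b \<in> B" using D mem by (auto simp: derivation_closed)
  have split: "(D ^^ Suc n) (a * b) = (D ^^ n) (D a * b) + (D ^^ n) (a * D b)"
    using D mem Dab
    by (simp add: funpow_Suc_right derivation_mult derivation_funpow_add mult_closed del: funpow.simps)
  show ?case
  \<comment> \<open>If \<open>p\<close> or \<open>q\<close> is zero, the corresponding factor is
    already killed by \<open>D\<close> and only one of the two terms survives.\<close>
  proof (cases p)
    case 0
    have "D a = 0" using Suc.prems(3) 0 by simp
    moreover obtain q' where q: "q = Suc q'" using Suc.hyps(2) 0 by (cases q) auto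
    moreover have "(D ^^ n) (a * D b) = a * (D ^^ q') (D b)"
      using Suc.hyps(1)[of 0 q' a "D b"] Suc.hyps(2) Suc.prems 0 q Dab
      by (simp add: funpow_swap1)
    ultimately show ?thesis
      using split D 0 Suc.hyps(2) by (simp add: funpow_zero funpow_swap1)
  next
    case p: (Suc p')
    have left: "(D ^^ n) (D a * b) = of_nat (n choose p') * ((D ^^ p) a * (D ^^ q) b)"
      using Suc.hyps(1)[of p' q "D a" b] Suc.hyps(2) Suc.prems p Dab
      by (simp add: funpow_swap1)
    show ?thesis
    proof (cases q)
      case 0
      have "D b = 0" using Suc.prems(4) 0 by simp
      then show ?thesis
        using split left D 0 p Suc.hyps(2) by (simp add: funpow_zero)
    next
      case q: (Suc q')
      have right: "(D ^^ n) (a * D b) = of_nat (n choose p) * ((D ^^ p) a * (D ^^ q) b)"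
        using Suc.hyps(1)[of p q' a "D b"] Suc.hyps(2) Suc.prems q Dab
        by (simp add: funpow_swap1)
      \<comment> \<open>The two binomial coefficients add up by Pascal's rule.\<close>
      have "p + q = Suc n" using Suc.hyps(2) by simp
      then show ?thesis
        using split left right p by (simp add: algebra_simps del: funpow.simps)
    qed
  qed
qed

text \<open>At order \<open>p + q\<close> the iterate is an integer multiple of
  \<open>(D ^^ p) a * (D ^^ q) b\<close>, and \<open>D\<close> kills both factors.\<close>

lemma funpow_mult_zero:
  assumes D: "derivation D" and mem: "a \<in> B" "b \<in> B"
    and "(D ^^ Suc p) a = 0" "(D ^^ Suc q) b = 0"
  shows "(D ^^ Suc (p + q)) (a * b) = 0"
proof -
  have "(D ^^ Suc (p + q)) (a * b) = D (\<iota> (of_nat ((p + q) choose p)) * ((D ^^ p) a * (D ^^ q) b))"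
    using funpow_mult_top[OF assms] by (simp add: scalar_of_nat)
  then show ?thesis
    using assms by (simp add: derivation_scale derivation_mult funpow_closed mult_closed)
qed

lemma nilpotent_mult:
  assumes "derivation D" "a \<in> B" "b \<in> B" "\<exists>k. (D ^^ k) a = 0" "\<exists>k. (D ^^ k) b = 0"
  shows "\<exists>k. (D ^^ k) (a * b) = 0"
proof -
  obtain p q where "(D ^^ p) a = 0" "(D ^^ q) b = 0" using assms(4,5) by blast
  then have "(D ^^ Suc p) a = 0" "(D ^^ Suc q) b = 0"
    using assms(1) by (simp_all add: derivation_zero)
  then show ?thesis using funpow_mult_zero[OF assms(1-3)] by blast
qed

lemma nilpotent_add:
  assumes "derivation D" "a \<in> B" "b \<in> B" "\<exists>k. (D ^^ k) a = 0" "\<exists>k. (D ^^ k) b = 0"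
  shows "\<exists>k. (D ^^ k) (a + b) = 0"
proof -
  obtain p q where "(D ^^ p) a = 0" "(D ^^ q) b = 0" using assms(4,5) by blast
  then have "(D ^^ (p + q)) a = 0" "(D ^^ (p + q)) b = 0"
    using funpow_eq_zero_mono[OF assms(1)] by auto
  then show ?thesis using assms by (metis derivation_funpow_add add_0)
qed

text \<open>The degree function of a locally nilpotent derivation: for nonzero \<open>a\<close> the
  largest \<open>k\<close> with \<open>(D ^^ k) a \<noteq> 0\<close>. At \<open>0\<close> a
  derivation gets the value \<open>0\<close> instead of minus infinity, hence the nonzero
  assumptions below.\<close>

definition nil_degree :: "('b \<Rightarrow> 'b) \<Rightarrow> 'b \<Rightarrow> nat" where
  "nil_degree D a = (LEAST k. (D ^^ Suc k) a = 0)"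

lemma nil_degreeI:
  assumes "derivation D" "(D ^^ k) a \<noteq> 0" "(D ^^ Suc k) a = 0"
  shows "nil_degree D a = k"
  unfolding nil_degree_def
proof (rule Least_equality)
  fix l assume "(D ^^ Suc l) a = 0"
  then show "k \<le> l"
    using funpow_eq_zero_mono[OF assms(1), of "Suc l" a k] assms(2) by fastforce
qed (use assms(3) in simp)

lemma nil_degree:
  assumes "lnd D" "a \<in> B" "a \<noteq> 0"
  shows "(D ^^ nil_degree D a) a \<noteq> 0" "(D ^^ Suc (nil_degree D a)) a = 0"
proof -
  have ex: "\<exists>k. (D ^^ Suc k) a = 0"
    using assms(1,2) derivation_zero[OF lnd_derivation[OF assms(1)]]
    by (metis funpow.simps(2) comp_apply lnd_def)
  then show "(D ^^ Suc (nil_degree D a)) a = 0"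
    unfolding nil_degree_def by (rule LeastI_ex)
  show "(D ^^ nil_degree D a) a \<noteq> 0"
  proof (cases "nil_degree D a")
    case 0
    then show ?thesis using assms(3) by simp
  next
    case (Suc l)
    then show ?thesis
      using not_less_Least[of l "\<lambda>k. (D ^^ Suc k) a = 0"] by (simp add: nil_degree_def)
  qed
qed

text \<open>The top iterate of \<open>a * b\<close> is a binomial coefficient times the product of
  the top iterates of \<open>a\<close> and \<open>b\<close>, which is nonzero in a domain of
  characteristic zero.\<close>

lemma nil_degree_mult:
  assumes "lnd D" "a \<in> B" "b \<in> B" "a \<noteq> 0" "b \<noteq> 0"
  shows "nil_degree D (a * b) = nil_degree D a + nil_degree D b"
proof -
  note D = lnd_derivation[OF assms(1)]
  note a = nil_degree[OF assms(1,2,4)] and b = nil_degree[OF assms(1,3,5)]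
  have "(D ^^ (nil_degree D a + nil_degree D b)) (a * b) \<noteq> 0"
    unfolding funpow_mult_top[OF D assms(2,3) a(2) b(2)]
    using of_nat_mult_eq_zero mult_nonzero[OF _ _ a(1) b(1)] funpow_closed[OF D] assms(2,3)
    by fastforce
  then show ?thesis
    using nil_degreeI[OF D _ funpow_mult_zero[OF D assms(2,3) a(2) b(2)]] by blast
qed

lemma nil_degree_power_mult:
  assumes "lnd D" "a \<in> B" "b \<in> B" "a \<noteq> 0" "b \<noteq> 0"
  shows "nil_degree D (a ^ j * b) = j * nil_degree D a + nil_degree D b"
  using assms
  by (induction j)
    (auto simp: mult.assoc nil_degree_mult power_mult_closed power_mult_nonzero)

lemma nil_degree_scale:
  assumes "lnd D" "a \<in> B" "a \<noteq> 0" "c \<noteq> 0"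
  shows "nil_degree D (\<iota> c * a) = nil_degree D a"
proof (rule nil_degreeI)
  note D = lnd_derivation[OF assms(1)]
  show "derivation D" by (fact D)
  show "(D ^^ nil_degree D a) (\<iota> c * a) \<noteq> 0"
    using nil_degree[OF assms(1-3)] scale_eq_zero assms(4)
    by (auto simp: funpow_scale[OF D assms(2)])
  show "(D ^^ Suc (nil_degree D a)) (\<iota> c * a) = 0"
    unfolding funpow_scale[OF D assms(2)] nil_degree(2)[OF assms(1-3)] by simp
qed

lemma nil_degree_derivation:
  assumes "lnd D" "a \<in> B" "D a \<noteq> 0"
  shows "nil_degree D a = Suc (nil_degree D (D a))"
proof -
  note D = lnd_derivation[OF assms(1)]
  show ?thesis
    using nil_degree[OF assms(1) derivation_closed[OF D assms(2)] assms(3)]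
    by (intro nil_degreeI) (auto simp: D funpow_swap1)
qed

lemma nil_degree_kernel: "derivation D \<Longrightarrow> a \<noteq> 0 \<Longrightarrow> D a = 0 \<Longrightarrow> nil_degree D a = 0"
  by (rule nil_degreeI) auto

end

section \<open>Gradings with components of dimension at most one\<close>

text \<open>\<open>comp_spans\<close> and \<open>comp_independent\<close> together encode a direct
  sum decomposition. The open orbit enters the algebraic argument only through
  \<open>comp_proportional\<close>.\<close>

locale graded_domain = scalar_domain B u \<iota> + comm_group G
  for B :: "'b::comm_ring_1 set" and u and \<iota> :: "'k::field_char_0 \<Rightarrow> 'b"
    and G :: "('g, 'm) monoid_scheme" (structure) +
  fixes comp :: "'g \<Rightarrow> 'b set"
  assumes comp_subset: "\<chi> \<in> carrier G \<Longrightarrow> f \<in> comp \<chi> \<Longrightarrow> f \<in> B"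
    and comp_add: "\<chi> \<in> carrier G \<Longrightarrow> f \<in> comp \<chi> \<Longrightarrow> g \<in> comp \<chi> \<Longrightarrow> f + g \<in> comp \<chi>"
    and comp_scale: "\<chi> \<in> carrier G \<Longrightarrow> f \<in> comp \<chi> \<Longrightarrow> \<iota> c * f \<in> comp \<chi>"
    and comp_mult: "\<chi> \<in> carrier G \<Longrightarrow> \<psi> \<in> carrier G \<Longrightarrow> f \<in> comp \<chi> \<Longrightarrow> g \<in> comp \<psi> \<Longrightarrow>
      f * g \<in> comp (\<chi> \<otimes> \<psi>)"
    and comp_zero: "\<chi> \<in> carrier G \<Longrightarrow> 0 \<in> comp \<chi>"
    and unit_comp: "u \<in> comp \<one>"
    and comp_spans: "f \<in> B \<Longrightarrow> \<exists>C g. finite C \<and> C \<subseteq> carrier G \<and> (\<forall>\<chi>\<in>C. g \<chi> \<in> comp \<chi>) \<and>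
      f = (\<Sum>\<chi>\<in>C. g \<chi>)"
    and comp_independent: "finite C \<Longrightarrow> C \<subseteq> carrier G \<Longrightarrow> (\<And>\<chi>. \<chi> \<in> C \<Longrightarrow> h \<chi> \<in> comp \<chi>) \<Longrightarrow>
      (\<Sum>\<chi>\<in>C. h \<chi>) = 0 \<Longrightarrow> \<chi> \<in> C \<Longrightarrow> h \<chi> = 0"
    and comp_proportional: "\<chi> \<in> carrier G \<Longrightarrow> f \<in> comp \<chi> \<Longrightarrow> g \<in> comp \<chi> \<Longrightarrow> f \<noteq> 0 \<Longrightarrow>
      \<exists>c. g = \<iota> c * f"
begin

section \<open>Homogeneous components of elements\<close>

definition decomposes :: "'b \<Rightarrow> ('g \<Rightarrow> 'b) \<Rightarrow> bool" where
  "decomposes f g \<longleftrightarrow> (\<exists>C. finite C \<and> C \<subseteq> carrier G \<and> (\<forall>\<chi>\<in>C. g \<chi> \<in> comp \<chi>) \<and>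
     (\<forall>\<chi>. \<chi> \<notin> C \<longrightarrow> g \<chi> = 0) \<and> f = (\<Sum>\<chi>\<in>C. g \<chi>))"

text \<open>For \<open>f \<in> B\<close> there is only one family to choose:
  \<open>decomposes\<close> prescribes the value \<open>0\<close> off a finite index set, and
  independence of the components does the rest.\<close>

definition part :: "'b \<Rightarrow> 'g \<Rightarrow> 'b" where
  "part f = (SOME g. decomposes f g)"

lemma decomposes_exists:
  assumes "f \<in> B"
  shows "\<exists>g. decomposes f g"
proof -
  obtain C g where C: "finite C" "C \<subseteq> carrier G" "\<forall>\<chi>\<in>C. g \<chi> \<in> comp \<chi>" "f = (\<Sum>\<chi>\<in>C. g \<chi>)"
    using comp_spans[OF assms] by blast
  then have "decomposes f (\<lambda>\<chi>. if \<chi> \<in> C then g \<chi> else 0)"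
    unfolding decomposes_def by (intro exI[of _ C]) auto
  then show ?thesis by blast
qed

lemma decomposes_sum:
  assumes "decomposes f g" "finite C" "\<And>\<chi>. g \<chi> \<noteq> 0 \<Longrightarrow> \<chi> \<in> C"
  shows "f = (\<Sum>\<chi>\<in>C. g \<chi>)"
proof -
  obtain C' where C': "finite C'" "\<forall>\<chi>. \<chi> \<notin> C' \<longrightarrow> g \<chi> = 0" "f = (\<Sum>\<chi>\<in>C'. g \<chi>)"
    using assms(1) unfolding decomposes_def by blast
  have "(\<Sum>\<chi>\<in>C'. g \<chi>) = (\<Sum>\<chi>\<in>C \<union> C'. g \<chi>)"
    using C' assms(2) by (intro sum.mono_neutral_left) auto
  also have "\<dots> = (\<Sum>\<chi>\<in>C. g \<chi>)"
    using C' assms(2,3) by (intro sum.mono_neutral_right) auto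
  finally show ?thesis using C'(3) by simp
qed

lemma decomposes_support:
  assumes "decomposes f g"
  shows "finite {\<chi>. g \<chi> \<noteq> 0}" "{\<chi>. g \<chi> \<noteq> 0} \<subseteq> carrier G"
proof -
  obtain C where "finite C" "C \<subseteq> carrier G" "{\<chi>. g \<chi> \<noteq> 0} \<subseteq> C"
    using assms unfolding decomposes_def by blast
  then show "finite {\<chi>. g \<chi> \<noteq> 0}" "{\<chi>. g \<chi> \<noteq> 0} \<subseteq> carrier G"
    using finite_subset by auto
qed

lemma decomposes_comp: "decomposes f g \<Longrightarrow> \<chi> \<in> carrier G \<Longrightarrow> g \<chi> \<in> comp \<chi>"
  unfolding decomposes_def using comp_zero by metis

lemma comp_diff: "\<chi> \<in> carrier G \<Longrightarrow> f \<in> comp \<chi> \<Longrightarrow> g \<in> comp \<chi> \<Longrightarrow> f - g \<in> comp \<chi>"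
  using comp_add[of \<chi> f "\<iota> (- 1) * g"] comp_scale[of \<chi> g "- 1"]
  by (simp add: scalar_minus scalar_one)

lemma decomposes_unique:
  assumes "decomposes f g" "decomposes f h"
  shows "g = h"
proof
  fix \<chi>
  define C where "C = {\<chi>. g \<chi> \<noteq> 0} \<union> {\<chi>. h \<chi> \<noteq> 0}"
  have C: "finite C" "C \<subseteq> carrier G"
    using decomposes_support[OF assms(1)] decomposes_support[OF assms(2)] by (auto simp: C_def)
  have "f = (\<Sum>\<chi>\<in>C. g \<chi>)" "f = (\<Sum>\<chi>\<in>C. h \<chi>)"
    using decomposes_sum[OF assms(1) C(1)] decomposes_sum[OF assms(2) C(1)] by (auto simp: C_def)
  then have sum: "(\<Sum>\<chi>\<in>C. g \<chi> - h \<chi>) = 0"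
    by (simp add: sum_subtractf)
  have "g \<chi> - h \<chi> \<in> comp \<chi>" if "\<chi> \<in> C" for \<chi>
    using that C(2) decomposes_comp[OF assms(1)] decomposes_comp[OF assms(2)] comp_diff by blast
  then have "\<chi> \<in> C \<Longrightarrow> g \<chi> - h \<chi> = 0"
    by (rule comp_independent[OF C _ sum])
  then show "g \<chi> = h \<chi>"
    by (cases "\<chi> \<in> C") (auto simp: C_def)
qed

lemma part_decomposes: "f \<in> B \<Longrightarrow> decomposes f (part f)"
  unfolding part_def using decomposes_exists by (rule someI_ex)

lemma part_eqI: "f \<in> B \<Longrightarrow> decomposes f g \<Longrightarrow> part f \<chi> = g \<chi>"
  using decomposes_unique part_decomposes by metis

lemma part_comp: "f \<in> B \<Longrightarrow> \<chi> \<in> carrier G \<Longrightarrow> part f \<chi> \<in> comp \<chi>"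
  using decomposes_comp part_decomposes by blast

lemma part_closed: "f \<in> B \<Longrightarrow> part f \<chi> \<in> B"
  using part_comp[of f \<chi>] comp_subset[of \<chi> "part f \<chi>"] zero_closed
    decomposes_support(2)[OF part_decomposes, of f]
  by (cases "part f \<chi> = 0") auto

lemma part_sum: "f \<in> B \<Longrightarrow> finite C \<Longrightarrow> {\<chi>. part f \<chi> \<noteq> 0} \<subseteq> C \<Longrightarrow> f = (\<Sum>\<chi>\<in>C. part f \<chi>)"
  by (rule decomposes_sum[OF part_decomposes]) auto

lemmas part_support = decomposes_support[OF part_decomposes]

lemma part_homogeneous:
  assumes "\<chi> \<in> carrier G" "f \<in> comp \<chi>"
  shows "part f \<psi> = (if \<psi> = \<chi> then f else 0)"
proof (rule part_eqI)
  show "decomposes f (\<lambda>\<psi>. if \<psi> = \<chi> then f else 0)"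
    unfolding decomposes_def by (rule exI[of _ "{\<chi>}"]) (simp add: assms)
qed (rule comp_subset[OF assms])

lemma part_zero: "part 0 \<psi> = 0"
  using part_homogeneous[OF one_closed comp_zero] by simp

lemma part_add:
  assumes "f \<in> B" "g \<in> B"
  shows "part (f + g) \<chi> = part f \<chi> + part g \<chi>"
proof (rule part_eqI)
  define C where "C = {\<chi>. part f \<chi> \<noteq> 0} \<union> {\<chi>. part g \<chi> \<noteq> 0}"
  have C: "finite C" "C \<subseteq> carrier G" using part_support assms by (auto simp: C_def)
  show "decomposes (f + g) (\<lambda>\<chi>. part f \<chi> + part g \<chi>)"
    unfolding decomposes_def
  proof (intro exI[of _ C] conjI ballI allI impI)
    show "part f \<psi> + part g \<psi> \<in> comp \<psi>" if "\<psi> \<in> C" for \<psi>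
      using that C assms part_comp comp_add by blast
    have "f = (\<Sum>\<chi>\<in>C. part f \<chi>)" "g = (\<Sum>\<chi>\<in>C. part g \<chi>)"
      using part_sum assms C(1) by (auto simp: C_def)
    then show "f + g = (\<Sum>\<chi>\<in>C. part f \<chi> + part g \<chi>)"
      by (simp add: sum.distrib)
  qed (use C in \<open>auto simp: C_def\<close>)
qed (use assms add_closed in auto)

lemma part_scale:
  assumes "f \<in> B"
  shows "part (\<iota> c * f) \<chi> = \<iota> c * part f \<chi>"
proof (rule part_eqI)
  show "decomposes (\<iota> c * f) (\<lambda>\<chi>. \<iota> c * part f \<chi>)"
    unfolding decomposes_def
  proof (intro exI[of _ "{\<chi>. part f \<chi> \<noteq> 0}"] conjI ballI allI impI)
    show "\<iota> c * part f \<psi> \<in> comp \<psi>" if "\<psi> \<in> {\<chi>. part f \<chi> \<noteq> 0}" for \<psi>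
      using that part_support[OF assms] assms part_comp comp_scale by blast
    show "\<iota> c * f = (\<Sum>\<chi> | part f \<chi> \<noteq> 0. \<iota> c * part f \<chi>)"
      using part_sum[OF assms part_support(1)[OF assms]] by (simp flip: sum_distrib_left)
  qed (use part_support[OF assms] in auto)
qed (use assms scale_closed in auto)

lemma part_sum_distrib:
  assumes "\<And>i. i \<in> I \<Longrightarrow> f i \<in> B"
  shows "part (\<Sum>i\<in>I. f i) \<chi> = (\<Sum>i\<in>I. part (f i) \<chi>)"
  using assms
  by (induction I rule: infinite_finite_induct) (auto simp: part_zero part_add sum_closed)

text \<open>Reduces statements that are additive in \<open>f\<close>, such as the Leibniz rule or
  nilpotency, to homogeneous arguments.\<close>

lemma homogeneous_induct [consumes 1, case_names homogeneous add]:
  assumes "f \<in> B"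
    and hom: "\<And>\<chi> f. \<chi> \<in> carrier G \<Longrightarrow> f \<in> comp \<chi> \<Longrightarrow> P f"
    and add: "\<And>f g. f \<in> B \<Longrightarrow> g \<in> B \<Longrightarrow> P f \<Longrightarrow> P g \<Longrightarrow> P (f + g)"
  shows "P f"
proof -
  have "P (\<Sum>\<chi>\<in>C. part f \<chi>)" if "finite C" "C \<subseteq> carrier G" for C
    using that
  proof (induction C rule: finite_induct)
    case empty
    then show ?case using hom[OF one_closed comp_zero] by simp
  next
    case (insert \<chi> C)
    then have "P (part f \<chi> + sum (part f) C)"
      using assms(1) hom[of \<chi>, OF _ part_comp] by (intro add part_closed sum_closed) auto
    then show ?case using insert by simp
  qed
  from this[OF part_support[OF assms(1)]] show ?thesis
    by (simp flip: part_sum[OF assms(1) part_support(1)[OF assms(1)] order_refl])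
qed

text \<open>Multiplication by \<open>g\<close> shifts every degree by \<open>\<psi>\<close>, and
  translation in a group is injective, so only the component of degree \<open>\<chi>\<close>
  contributes.\<close>

lemma part_mult_homogeneous:
  assumes "f \<in> B" "\<chi> \<in> carrier G" "\<psi> \<in> carrier G" "g \<in> comp \<psi>"
  shows "part (f * g) (\<chi> \<otimes> \<psi>) = part f \<chi> * g"
  using assms(1)
proof (induction rule: homogeneous_induct)
  case (homogeneous \<eta> f)
  then have "part (f * g) (\<chi> \<otimes> \<psi>) = (if \<chi> \<otimes> \<psi> = \<eta> \<otimes> \<psi> then f * g else 0)"
    using assms by (intro part_homogeneous comp_mult) auto
  then show ?case
    using homogeneous assms by (simp add: part_homogeneous)
next
  case (add f f')
  then show ?case
    using assms comp_subset by (simp add: distrib_right part_add mult_closed)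
qed

definition homogeneous :: "'g \<Rightarrow> ('b \<Rightarrow> 'b) \<Rightarrow> bool" where
  "homogeneous e D \<longleftrightarrow> (\<forall>\<chi>\<in>carrier G. \<forall>f\<in>comp \<chi>. D f \<in> comp (\<chi> \<otimes> e))"

lemma homogeneousD: "homogeneous e D \<Longrightarrow> \<chi> \<in> carrier G \<Longrightarrow> f \<in> comp \<chi> \<Longrightarrow> D f \<in> comp (\<chi> \<otimes> e)"
  by (simp add: homogeneous_def)

text \<open>Translation by \<open>e\<close> keeps distinct degrees distinct. Consequently the kernel
  of a homogeneous derivation contains the homogeneous components of its elements.\<close>

lemma homogeneous_part:
  assumes D: "derivation D" and e: "homogeneous e D" "e \<in> carrier G"
    and "f \<in> B" "\<chi> \<in> carrier G"
  shows "part (D f) (\<chi> \<otimes> e) = D (part f \<chi>)"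
  using assms(4)
proof (induction rule: homogeneous_induct)
  case (homogeneous \<eta> f)
  then have "part (D f) (\<chi> \<otimes> e) = (if \<chi> \<otimes> e = \<eta> \<otimes> e then D f else 0)"
    using e by (intro part_homogeneous homogeneousD[OF e(1)]) auto
  then show ?case
    using homogeneous assms by (simp add: part_homogeneous derivation_zero)
next
  case (add f f')
  then show ?case
    by (simp add: derivation_add[OF D] part_add derivation_closed[OF D] part_closed)
qed

lemma homogeneous_funpow:
  assumes "homogeneous e D" "e \<in> carrier G" "\<chi> \<in> carrier G" "f \<in> comp \<chi>"
  shows "\<exists>\<psi>\<in>carrier G. (D ^^ j) f \<in> comp \<psi>"
proof (induction j)
  case (Suc j)
  then show ?case
    using homogeneousD[OF assms(1)] m_closed[OF _ assms(2)] by (metis comp_apply funpow.simps(2))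
qed (use assms in auto)

section \<open>Homogeneous components of a derivation\<close>

definition homogeneous_part_of :: "('b \<Rightarrow> 'b) \<Rightarrow> 'g \<Rightarrow> 'b \<Rightarrow> 'b" where
  "homogeneous_part_of D e f = (\<Sum>\<chi> | part f \<chi> \<noteq> 0. part (D (part f \<chi>)) (\<chi> \<otimes> e))"

context
  fixes D e
  assumes D: "derivation D" and e: "e \<in> carrier G"
begin

text \<open>The index set may be enlarged because \<open>D 0 = 0\<close>; this puts
  \<open>f\<close>, \<open>g\<close> and \<open>f + g\<close> over one index set although their
  supports differ.\<close>

lemma homogeneous_part_of_sum:
  assumes "f \<in> B" "finite C" "{\<chi>. part f \<chi> \<noteq> 0} \<subseteq> C"
  shows "homogeneous_part_of D e f = (\<Sum>\<chi>\<in>C. part (D (part f \<chi>)) (\<chi> \<otimes> e))"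
  unfolding homogeneous_part_of_def
  using assms by (intro sum.mono_neutral_left) (auto simp: part_zero derivation_zero[OF D])

lemma homogeneous_part_of_homogeneous:
  assumes "\<chi> \<in> carrier G" "f \<in> comp \<chi>"
  shows "homogeneous_part_of D e f = part (D f) (\<chi> \<otimes> e)"
  using assms comp_subset
  by (subst homogeneous_part_of_sum[where C = "{\<chi>}"]) (auto simp: part_homogeneous)

lemma homogeneous_homogeneous_part_of: "homogeneous e (homogeneous_part_of D e)"
  using e comp_subset
  by (auto simp: homogeneous_def homogeneous_part_of_homogeneous
      intro!: part_comp derivation_closed[OF D])

lemma homogeneous_part_of_closed:
  assumes "f \<in> B"
  shows "homogeneous_part_of D e f \<in> B"
  unfolding homogeneous_part_of_def
  using assms by (intro sum_closed part_closed derivation_closed[OF D]) auto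

lemma homogeneous_part_of_add:
  assumes "f \<in> B" "g \<in> B"
  shows "homogeneous_part_of D e (f + g) = homogeneous_part_of D e f + homogeneous_part_of D e g"
proof -
  define C where "C = {\<chi>. part f \<chi> \<noteq> 0} \<union> {\<chi>. part g \<chi> \<noteq> 0}"
  have C: "finite C" using part_support assms by (auto simp: C_def)
  have "homogeneous_part_of D e h = (\<Sum>\<chi>\<in>C. part (D (part h \<chi>)) (\<chi> \<otimes> e))"
    if "h \<in> {f, g, f + g}" for h
    using that assms C
    by (intro homogeneous_part_of_sum) (auto simp: C_def part_add add_closed)
  then show ?thesis
    using assms
    by (simp add: part_add derivation_add[OF D] derivation_closed[OF D] part_closed sum.distrib)
qed

lemma homogeneous_part_of_scale:
  assumes "f \<in> B"
  shows "homogeneous_part_of D e (\<iota> c * f) = \<iota> c * homogeneous_part_of D e f"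
proof -
  have "homogeneous_part_of D e h =
      (\<Sum>\<chi> | part f \<chi> \<noteq> 0. part (D (part h \<chi>)) (\<chi> \<otimes> e))"
    if "h \<in> {f, \<iota> c * f}" for h
    using that assms part_support[OF assms]
    by (intro homogeneous_part_of_sum) (auto simp: part_scale scale_closed)
  then show ?thesis
    using assms
    by (simp add: part_scale derivation_scale[OF D] derivation_closed[OF D] part_closed
        sum_distrib_left)
qed

text \<open>Both sides are biadditive, so homogeneous factors suffice; for these the identity is the
  component of degree \<open>\<chi> \<otimes> \<psi> \<otimes> e\<close> of the Leibniz rule for
  \<open>D\<close>.\<close>

lemma homogeneous_part_of_mult:
  assumes "f \<in> B" "g \<in> B"
  shows "homogeneous_part_of D e (f * g) =
    homogeneous_part_of D e f * g + f * homogeneous_part_of D e g" (is "?L f g")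
  using assms(1)
proof (induction rule: homogeneous_induct)
  case (homogeneous \<chi> f)
  show ?case using assms(2)
  proof (induction rule: homogeneous_induct)
    case (homogeneous \<psi> g)
    note f = \<open>\<chi> \<in> carrier G\<close> \<open>f \<in> comp \<chi>\<close>
    have "part (D f * g) (\<chi> \<otimes> e \<otimes> \<psi>) = part (D f) (\<chi> \<otimes> e) * g"
      using f homogeneous e by (intro part_mult_homogeneous) (auto intro: derivation_closed[OF D] comp_subset)
    \<comment> \<open>\<open>f\<close> is moved to the right, where
      \<open>part_mult_homogeneous\<close> expects the homogeneous factor.\<close>
    moreover have "part (D g * f) (\<psi> \<otimes> e \<otimes> \<chi>) = part (D g) (\<psi> \<otimes> e) * f"
      using f homogeneous e by (intro part_mult_homogeneous) (auto intro: derivation_closed[OF D] comp_subset)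
    moreover have "\<chi> \<otimes> e \<otimes> \<psi> = \<chi> \<otimes> \<psi> \<otimes> e" "\<psi> \<otimes> e \<otimes> \<chi> = \<chi> \<otimes> \<psi> \<otimes> e"
      using f homogeneous e by (simp_all add: m_ac)
    moreover have "homogeneous_part_of D e (f * g) = part (D (f * g)) (\<chi> \<otimes> \<psi> \<otimes> e)"
      using f homogeneous by (intro homogeneous_part_of_homogeneous comp_mult) auto
    moreover have "part (D (f * g)) \<eta> = part (D f * g) \<eta> + part (D g * f) \<eta>" for \<eta>
      using f homogeneous comp_subset
      by (simp add: derivation_mult[OF D] part_add mult_closed derivation_closed[OF D] mult.commute)
    ultimately show ?case
      using f homogeneous
      by (simp add: homogeneous_part_of_homogeneous[of \<chi>] homogeneous_part_of_homogeneous[of \<psi>]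
          mult.commute)
  next
    case (add g g')
    then show ?case
      using comp_subset[OF homogeneous]
      by (simp add: distrib_left homogeneous_part_of_add mult_closed)
  qed
next
  case (add f f')
  then show ?case
    using assms(2) by (simp add: distrib_right homogeneous_part_of_add mult_closed)
qed

lemma derivation_homogeneous_part_of: "derivation (homogeneous_part_of D e)"
  unfolding derivation_def
  by (simp add: homogeneous_part_of_closed homogeneous_part_of_add homogeneous_part_of_scale
      homogeneous_part_of_mult)

text \<open>The elements killed by some iterate are closed under addition, so a failure of local
  nilpotency already shows on a homogeneous element.\<close>

lemma not_lnd_homogeneous_part_of:
  assumes "\<not> lnd (homogeneous_part_of D e)"
  obtains \<chi> a where "\<chi> \<in> carrier G" "a \<in> comp \<chi>" "\<And>j. (homogeneous_part_of D e ^^ j) a \<noteq> 0"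
proof -
  have "\<exists>\<chi>\<in>carrier G. \<exists>a\<in>comp \<chi>. \<forall>j. (homogeneous_part_of D e ^^ j) a \<noteq> 0"
  proof (rule ccontr)
    assume neg: "\<not> ?thesis"
    have "\<exists>j. (homogeneous_part_of D e ^^ j) f = 0" if "f \<in> B" for f
      using that
    proof (induction rule: homogeneous_induct)
      case (homogeneous \<chi> f)
      then show ?case using neg by blast
    next
      case (add f g)
      then show ?case by (intro nilpotent_add[OF derivation_homogeneous_part_of])
    qed
    then show False
      using assms derivation_homogeneous_part_of by (simp add: lnd_def)
  qed
  then show thesis using that by blast
qed

end

end

context graded_domain
begin

section \<open>Elements almost integral over the algebra\<close>

text \<open>For \<open>x\<close> and nonzero \<open>f\<close> in \<open>B\<close> this says, without
  fractions, that \<open>x / f\<close> is almost integral over \<open>B\<close>: one denominator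
  \<open>h\<close> serves all powers.\<close>

definition almost_integral_quotient :: "'b \<Rightarrow> 'b \<Rightarrow> bool" where
  "almost_integral_quotient x f \<longleftrightarrow> (\<exists>h\<in>B. h \<noteq> 0 \<and> (\<forall>j. \<exists>b\<in>B. h * x ^ j = f ^ j * b))"

text \<open>\<open>h * h'\<close> is a common denominator for the powers of the sum: in each
  binomial term \<open>h\<close> absorbs the power of \<open>x\<close> and \<open>h'\<close> the
  power of \<open>y\<close>.\<close>

lemma almost_integral_quotient_add:
  assumes "almost_integral_quotient x f" "almost_integral_quotient y f"
  shows "almost_integral_quotient (x + y) f"
proof -
  obtain h h' where h: "h \<in> B" "h \<noteq> 0" "\<And>j. \<exists>b\<in>B. h * x ^ j = f ^ j * b"
    and h': "h' \<in> B" "h' \<noteq> 0" "\<And>j. \<exists>b\<in>B. h' * y ^ j = f ^ j * b"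
    using assms unfolding almost_integral_quotient_def by blast
  obtain p q where p: "\<And>j. p j \<in> B" "\<And>j. h * x ^ j = f ^ j * p j"
    and q: "\<And>j. q j \<in> B" "\<And>j. h' * y ^ j = f ^ j * q j"
    using h(3) h'(3) by metis
  have "\<exists>b\<in>B. h * h' * (x + y) ^ j = f ^ j * b" for j
  proof
    let ?b = "\<Sum>i\<le>j. of_nat (j choose i) * (p i * q (j - i))"
    show "?b \<in> B"
      using p q by (intro sum_closed of_nat_mult_closed mult_closed)
    have "h * h' * (of_nat (j choose i) * x ^ i * y ^ (j - i)) =
        f ^ j * (of_nat (j choose i) * (p i * q (j - i)))" if "i \<le> j" for i
    proof -
      have "h * h' * (of_nat (j choose i) * x ^ i * y ^ (j - i)) =
          of_nat (j choose i) * ((h * x ^ i) * (h' * y ^ (j - i)))"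
        by (simp add: algebra_simps)
      also have "\<dots> = (f ^ i * f ^ (j - i)) * (of_nat (j choose i) * (p i * q (j - i)))"
        by (simp only: p q) (simp add: algebra_simps)
      finally show ?thesis using that by (simp flip: power_add)
    qed
    then show "h * h' * (x + y) ^ j = f ^ j * ?b"
      unfolding binomial_ring sum_distrib_left by (intro sum.cong) auto
  qed
  then show ?thesis
    unfolding almost_integral_quotient_def using h h' mult_closed mult_nonzero by blast
qed

lemma almost_integral_quotient_zero: "almost_integral_quotient 0 f"
  unfolding almost_integral_quotient_def
proof (rule bexI[of _ u], rule conjI, safe)
  \<comment> \<open>Since \<open>0 ^ 0 = 1\<close>, the witness for \<open>j = 0\<close> is
    \<open>u\<close>; for all other \<open>j\<close> it is \<open>0\<close>.\<close>
  fix j show "\<exists>b\<in>B. u * 0 ^ j = f ^ j * b"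
    using zero_closed unit_closed by (cases j) (auto intro: bexI[of _ 0])
qed (auto simp: unit_closed unit_nonzero)

lemma almost_integral_quotient_sum:
  "(\<And>i. i \<in> I \<Longrightarrow> almost_integral_quotient (x i) f) \<Longrightarrow> almost_integral_quotient (\<Sum>i\<in>I. x i) f"
  by (induction I rule: infinite_finite_induct)
    (auto simp: almost_integral_quotient_zero almost_integral_quotient_add)

text \<open>A quotient \<open>D f / f\<close> would have degree -1, so its powers have unbounded denominators.\<close>

lemma not_almost_integral_quotient_lnd:
  assumes D: "lnd D" and f: "f \<in> B" and Df: "D f \<noteq> 0"
  shows "\<not> almost_integral_quotient (D f) f"
proof
  assume "almost_integral_quotient (D f) f"
  then obtain h where h: "h \<in> B" "h \<noteq> 0" "\<And>j. \<exists>b\<in>B. h * D f ^ j = f ^ j * b"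
    unfolding almost_integral_quotient_def by blast
  \<comment> \<open>One more than the degree of \<open>h\<close>: the comparison of degrees gives
    \<open>nil_degree D h = j + nil_degree D b\<close>, which is then impossible.\<close>
  define j where "j = Suc (nil_degree D h)"
  obtain b where b: "b \<in> B" "D f ^ j * h = f ^ j * b"
    using h(3)[of j] by (auto simp: mult.commute)
  note DfB = derivation_closed[OF lnd_derivation[OF D] f]
  have f0: "f \<noteq> 0" using Df derivation_zero[OF lnd_derivation[OF D]] by auto
  have b0: "b \<noteq> 0"
    using power_mult_nonzero[OF DfB h(1) Df h(2), of j] b(2) by auto
  have "j * nil_degree D (D f) + nil_degree D h = j * nil_degree D f + nil_degree D b"
    using nil_degree_power_mult[OF D DfB h(1) Df h(2), of j]
      nil_degree_power_mult[OF D f b(1) f0 b0, of j] b(2) by simp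
  then show False
    using nil_degree_derivation[OF D f Df] by (simp add: j_def)
qed

text \<open>If the component of degree \<open>e\<close> is not locally nilpotent, then all its iterates on some
  homogeneous \<open>a\<close> are nonzero, and in each degree of \<open>a \<otimes> e\<^sup>j\<close> they are the only elements up to scalars.\<close>

lemma almost_integral_quotient_homogeneous:
  assumes D: "derivation D" and e: "e \<in> carrier G"
    and not: "\<not> lnd (homogeneous_part_of D e)"
    and f: "\<psi> \<in> carrier G" "f \<in> comp \<psi>"
  shows "almost_integral_quotient (homogeneous_part_of D e f) f"
proof -
  define E where "E = homogeneous_part_of D e"
  obtain \<chi> a where a: "\<chi> \<in> carrier G" "a \<in> comp \<chi>" "\<And>j. (E ^^ j) a \<noteq> 0"
    using not_lnd_homogeneous_part_of[OF D e not] unfolding E_def by metis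
  have E: "homogeneous e E"
    unfolding E_def by (rule homogeneous_homogeneous_part_of[OF D e])
  have closed: "(E ^^ j) a \<in> B" for j
    using homogeneous_funpow[OF E e a(1,2), of j] comp_subset by blast
  show ?thesis
  proof (cases "f = 0")
    case True
    then have "E f = 0" unfolding E_def using D e
      by (simp add: derivation_zero[OF derivation_homogeneous_part_of])
    then show ?thesis by (simp add: E_def[symmetric] almost_integral_quotient_zero)
  next
    case False
    \<comment> \<open>Each step of the induction trades a factor \<open>E f\<close> for a factor
      \<open>f\<close>, as \<open>E f * (E ^^ j) a\<close> and \<open>f * (E ^^ Suc j) a\<close> lie
      in the same component.\<close>
    have "\<exists>c. a * E f ^ j = f ^ j * (\<iota> c * (E ^^ j) a)" for j
    proof (induction j)
      case 0
      show ?case by (rule exI[of _ 1]) (simp add: scalar_one)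
    next
      case (Suc j)
      then obtain c where c: "a * E f ^ j = f ^ j * (\<iota> c * (E ^^ j) a)" by blast
      obtain \<eta> where \<eta>: "\<eta> \<in> carrier G" "(E ^^ j) a \<in> comp \<eta>"
        using homogeneous_funpow[OF E e a(1,2)] by blast
      have "f * (E ^^ Suc j) a \<in> comp (\<psi> \<otimes> (\<eta> \<otimes> e))"
        using f \<eta> e homogeneousD[OF E \<eta>] by (auto intro!: comp_mult)
      moreover have "E f * (E ^^ j) a \<in> comp (\<psi> \<otimes> e \<otimes> \<eta>)"
        using f \<eta> e homogeneousD[OF E f] by (auto intro!: comp_mult)
      moreover have "\<psi> \<otimes> e \<otimes> \<eta> = \<psi> \<otimes> (\<eta> \<otimes> e)"
        using f \<eta> e by (simp add: m_ac)
      moreover have "f * (E ^^ Suc j) a \<noteq> 0"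
        using comp_subset[OF f] closed[of "Suc j"] False a(3)[of "Suc j"] by (rule mult_nonzero)
      ultimately obtain d where d: "E f * (E ^^ j) a = \<iota> d * (f * (E ^^ Suc j) a)"
        using comp_proportional[of "\<psi> \<otimes> (\<eta> \<otimes> e)" "f * (E ^^ Suc j) a" "E f * (E ^^ j) a"] f \<eta> e
        by auto
      have "a * E f ^ Suc j = (a * E f ^ j) * E f" by (simp add: algebra_simps)
      also have "\<dots> = f ^ j * \<iota> c * (E f * (E ^^ j) a)" by (simp only: c) (simp add: algebra_simps)
      also have "\<dots> = f ^ Suc j * (\<iota> (c * d) * (E ^^ Suc j) a)"
        by (simp only: d) (simp add: algebra_simps scalar_mult)
      finally show ?case by blast
    qed
    then have "\<forall>j. \<exists>b\<in>B. a * E f ^ j = f ^ j * b"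
      using closed scale_closed by metis
    then show ?thesis
      unfolding almost_integral_quotient_def E_def[symmetric]
      using comp_subset[OF a(1,2)] a(3)[of 0] by (intro bexI[of _ a]) auto
  qed
qed

section \<open>Kernels of homogeneous locally nilpotent derivations\<close>

text \<open>If \<open>D\<close> did not kill some component \<open>g\<close> of \<open>f\<close>,
  every nonzero component of \<open>D g\<close> would come from a component of \<open>D\<close> that
  is not locally nilpotent. Then \<open>D g / g\<close> would be a sum of almost integral quotients,
  against the drop of the \<open>D\<close>-degree.\<close>

theorem kernel_homogeneous_lnds:
  assumes D: "lnd D" and f: "f \<in> B"
    and hom: "\<And>e E. e \<in> carrier G \<Longrightarrow> lnd E \<Longrightarrow> homogeneous e E \<Longrightarrow> E f = 0"
  shows "D f = 0"
proof -
  note der = lnd_derivation[OF D]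
  have "D (part f \<chi>) = 0" if \<chi>: "\<chi> \<in> carrier G" for \<chi>
  proof (rule ccontr)
    define g where "g = part f \<chi>"
    have g: "g \<in> comp \<chi>" "g \<in> B" using f \<chi> by (auto simp: g_def part_comp part_closed)
    assume "D (part f \<chi>) \<noteq> 0"
    then have Dg: "D g \<noteq> 0" by (simp add: g_def)
    have DgB: "D g \<in> B" using derivation_closed[OF der] g by blast
    have "almost_integral_quotient (part (D g) \<eta>) g" if "part (D g) \<eta> \<noteq> 0" for \<eta>
    proof -
      \<comment> \<open>The degree shift from \<open>\<chi>\<close> to \<open>\<eta>\<close>, so
        that \<open>homogeneous_part_of D e\<close> yields exactly this component of
        \<open>D g\<close>.\<close>
      define e where "e = inv \<chi> \<otimes> \<eta>"
      have \<eta>: "\<eta> \<in> carrier G" using that part_support(2)[OF DgB] by blast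
      have e: "e \<in> carrier G" "\<chi> \<otimes> e = \<eta>"
        using \<chi> \<eta> by (auto simp: e_def simp flip: m_assoc)
      have Eg: "homogeneous_part_of D e g = part (D g) \<eta>"
        using homogeneous_part_of_homogeneous[OF der e(1) \<chi> g(1)] e(2) by simp
      have "\<not> lnd (homogeneous_part_of D e)"
      proof
        let ?E = "homogeneous_part_of D e"
        assume E: "lnd ?E"
        note homE = homogeneous_homogeneous_part_of[OF der e(1)]
        \<comment> \<open>The assumption \<open>hom\<close> speaks of \<open>f\<close>, not of
          \<open>g\<close>; homogeneity of \<open>?E\<close> transfers the vanishing to the
          components of \<open>f\<close>.\<close>
        have "?E g = part (?E f) (\<chi> \<otimes> e)"
          unfolding g_def using homogeneous_part[OF lnd_derivation[OF E] homE e(1) f \<chi>] by simp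
        then show False
          using hom[OF e(1) E homE] Eg that by (simp add: part_zero)
      qed
      then show ?thesis
        using almost_integral_quotient_homogeneous[OF der e(1) _ \<chi> g(1)] Eg by simp
    qed
    then have "almost_integral_quotient (D g) g"
      by (subst part_sum[OF DgB part_support(1)[OF DgB] order_refl])
        (auto intro: almost_integral_quotient_sum)
    then show False
      using not_almost_integral_quotient_lnd[OF D g(2) Dg] by blast
  qed
  moreover have "D f = (\<Sum>\<chi> | part f \<chi> \<noteq> 0. D (part f \<chi>))"
    using part_sum[OF f part_support(1)[OF f] order_refl]
      derivation_sum[OF der, of "{\<chi>. part f \<chi> \<noteq> 0}" "part f"] part_closed[OF f]
    by simp
  ultimately show ?thesis
    using part_support(2)[OF f] by (simp add: subset_iff)
qed

section \<open>Locally nilpotent derivations with a slice\<close>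

text \<open>Some component of \<open>s\<close> has an image under \<open>D\<close> whose part in the
  trivial degree is nonzero. The matching component of \<open>D\<close> sends it to a nonzero
  multiple of \<open>u\<close>, because the trivial degree is a line.\<close>

lemma homogeneous_slice:
  assumes D: "lnd D" and s: "s \<in> B" "D s = u"
  obtains d \<sigma> t where "lnd d" "\<sigma> \<in> carrier G" "homogeneous (inv \<sigma>) d" "t \<in> comp \<sigma>" "d t = u"
proof -
  note der = lnd_derivation[OF D]
  have "u = part (D s) \<one>"
    using part_homogeneous[OF one_closed unit_comp] s(2) by simp
  also have "D s = (\<Sum>\<chi> | part s \<chi> \<noteq> 0. D (part s \<chi>))"
    using part_sum[OF s(1) part_support(1)[OF s(1)] order_refl]
      derivation_sum[OF der, of "{\<chi>. part s \<chi> \<noteq> 0}" "part s"] part_closed[OF s(1)]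
    by simp
  also have "part \<dots> \<one> = (\<Sum>\<chi> | part s \<chi> \<noteq> 0. part (D (part s \<chi>)) \<one>)"
    using part_closed[OF s(1)] derivation_closed[OF der] by (intro part_sum_distrib) auto
  finally obtain \<sigma> where \<sigma>: "part s \<sigma> \<noteq> 0" "part (D (part s \<sigma>)) \<one> \<noteq> 0"
    using unit_nonzero by (metis (mono_tags, lifting) mem_Collect_eq sum.neutral)
  have \<sigma>G: "\<sigma> \<in> carrier G" using part_support(2)[OF s(1)] \<sigma>(1) by blast
  define r where "r = part s \<sigma>"
  define d where "d = homogeneous_part_of D (inv \<sigma>)"
  have r: "r \<in> comp \<sigma>" "r \<in> B" "r \<noteq> 0"
    using part_comp[OF s(1) \<sigma>G] part_closed[OF s(1)] \<sigma>(1) by (auto simp: r_def)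
  have Dr: "D r \<noteq> 0" using \<sigma>(2) by (auto simp: r_def part_zero)
  have e: "inv \<sigma> \<in> carrier G" using \<sigma>G by simp
  have dr: "d r = part (D r) \<one>"
    using homogeneous_part_of_homogeneous[OF der e \<sigma>G r(1)] \<sigma>G by (simp add: d_def)
  have homd: "homogeneous (inv \<sigma>) d"
    unfolding d_def by (rule homogeneous_homogeneous_part_of[OF der e])
  have lndd: "lnd d"
  proof (rule ccontr)
    assume "\<not> lnd d"
    then obtain \<chi> a where a: "\<chi> \<in> carrier G" "a \<in> comp \<chi>" "\<And>j. (d ^^ j) a \<noteq> 0"
      using not_lnd_homogeneous_part_of[OF der e] unfolding d_def by metis
    have closed: "(d ^^ j) a \<in> B" for j
      using homogeneous_funpow[OF homd e a(1,2), of j] comp_subset by blast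
    \<comment> \<open>Multiplication by \<open>r\<close> brings \<open>(d ^^ Suc j) a\<close> back
      to the degree of \<open>(d ^^ j) a\<close>, so the two become proportional. As
      \<open>D r \<noteq> 0\<close>, the factor \<open>r\<close> has positive
      \<open>D\<close>-degree, and the \<open>D\<close>-degree of the iterates would decrease
      forever.\<close>
    have step: "nil_degree D ((d ^^ Suc j) a) < nil_degree D ((d ^^ j) a)" for j
    proof -
      obtain \<eta> where \<eta>: "\<eta> \<in> carrier G" "(d ^^ j) a \<in> comp \<eta>"
        using homogeneous_funpow[OF homd e a(1,2)] by blast
      have "r * (d ^^ Suc j) a \<in> comp (\<sigma> \<otimes> (\<eta> \<otimes> inv \<sigma>))"
        using \<sigma>G \<eta> r homogeneousD[OF homd \<eta>] by (auto intro!: comp_mult)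
      moreover have "\<sigma> \<otimes> (\<eta> \<otimes> inv \<sigma>) = \<eta>"
        using \<sigma>G \<eta> by (metis e m_assoc m_comm m_closed r_inv r_one)
      ultimately have "\<exists>c. r * (d ^^ Suc j) a = \<iota> c * (d ^^ j) a"
        using comp_proportional[OF \<eta>] a(3)[of j] by simp
      then obtain c where c: "r * (d ^^ Suc j) a = \<iota> c * (d ^^ j) a" by blast
      have "c \<noteq> 0"
        using c mult_nonzero[OF r(2) closed r(3) a(3), of "Suc j"] by (auto simp: scalar_zero)
      then have "nil_degree D ((d ^^ j) a) = nil_degree D r + nil_degree D ((d ^^ Suc j) a)"
        using nil_degree_scale[OF D closed a(3)] nil_degree_mult[OF D r(2) closed r(3) a(3)] c
        by metis
      then show ?thesis using nil_degree_derivation[OF D r(2) Dr] by simp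
    qed
    have "nil_degree D ((d ^^ j) a) + j \<le> nil_degree D a" for j
    proof (induction j)
      case (Suc j)
      then show ?case using step[of j] by linarith
    qed simp
    from this[of "Suc (nil_degree D a)"] show False by simp
  qed
  have "d r \<in> comp \<one>" "d r \<noteq> 0"
    using dr \<sigma>(2) part_comp[OF derivation_closed[OF der r(2)] one_closed] by (auto simp: r_def)
  then obtain c where c: "u = \<iota> c * d r"
    using comp_proportional[OF one_closed _ unit_comp] by blast
  have "d (\<iota> c * r) = u"
    using c derivation_scale[OF lnd_derivation[OF lndd] r(2)] by simp
  then show thesis
    using that lndd \<sigma>G homd comp_scale[OF \<sigma>G r(1)] by blast
qed

section \<open>Homogeneous elements as monomials in a homogeneous slice\<close>

context
  fixes d \<sigma> s
  assumes d: "lnd d" and \<sigma>: "\<sigma> \<in> carrier G" and d_hom: "homogeneous (inv \<sigma>) d"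
    and s: "s \<in> comp \<sigma>" and ds: "d s = u"
begin

lemma slice_closed: "s \<in> B"
  using comp_subset \<sigma> s by blast

lemma slice_nonzero: "s \<noteq> 0"
  using ds derivation_zero[OF lnd_derivation[OF d]] unit_nonzero by auto

text \<open>\<open>d\<close> shifts degrees by \<open>inv \<sigma>\<close>, and multiplication by
  \<open>s\<close> shifts them back.\<close>

lemma slice_expansion_degree: "\<chi> \<in> carrier G \<Longrightarrow> b \<in> comp \<chi> \<Longrightarrow> s ^ j * (d ^^ j) b \<in> comp \<chi>"
proof (induction j arbitrary: b \<chi>)
  case (Suc j)
  have "d b \<in> comp (\<chi> \<otimes> inv \<sigma>)" using homogeneousD[OF d_hom] Suc.prems by blast
  then have "s * (s ^ j * (d ^^ j) (d b)) \<in> comp (\<sigma> \<otimes> (\<chi> \<otimes> inv \<sigma>))"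
    using Suc.prems \<sigma> s by (intro comp_mult Suc.IH) auto
  moreover have "\<sigma> \<otimes> (\<chi> \<otimes> inv \<sigma>) = \<chi>"
    using \<sigma> Suc.prems(1) by (metis inv_closed m_assoc m_comm m_closed r_inv r_one)
  ultimately show ?case by (simp add: funpow_swap1 mult.assoc)
qed simp

text \<open>In general an element is a polynomial in the slice over the kernel of \<open>d\<close>.
  Here \<open>s ^ k * (d ^^ k) b\<close>, with \<open>k\<close> the \<open>d\<close>-degree of
  \<open>b\<close>, is a nonzero element of the component of \<open>b\<close>, which is a line, so a
  single monomial remains.\<close>

lemma slice_expansion:
  assumes "\<chi> \<in> carrier G" "b \<in> comp \<chi>" "b \<noteq> 0"
  obtains a where "a \<in> B" "d a = 0" "b = s ^ nil_degree d b * a"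
proof -
  let ?k = "nil_degree d b"
  note der = lnd_derivation[OF d]
  have bB: "b \<in> B" using assms comp_subset by blast
  define a where "a = (d ^^ ?k) b"
  have a: "a \<in> B" "a \<noteq> 0" "d a = 0"
    using nil_degree[OF d bB assms(3)] funpow_closed[OF der bB] by (auto simp: a_def)
  obtain c where c: "b = \<iota> c * (s ^ ?k * a)"
    using comp_proportional[OF assms(1) slice_expansion_degree[OF assms(1,2)] assms(2)]
      power_mult_nonzero[OF slice_closed a(1) slice_nonzero a(2)] unfolding a_def by blast
  show thesis
  proof (rule that[of "\<iota> c * a"])
    show "\<iota> c * a \<in> B" "d (\<iota> c * a) = 0"
      using a scale_closed derivation_scale[OF der] by auto
    show "b = s ^ ?k * (\<iota> c * a)" by (subst c) (simp add: mult.left_commute)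
  qed
qed

section \<open>The twisted derivation\<close>

context
  fixes D e a\<^sub>0 \<chi>\<^sub>0
  assumes D: "lnd D" and e: "e \<in> carrier G" and D_hom: "homogeneous e D"
    and a\<^sub>0: "\<chi>\<^sub>0 \<in> carrier G" "a\<^sub>0 \<in> comp \<chi>\<^sub>0" "d a\<^sub>0 = 0" "D a\<^sub>0 \<noteq> 0"
begin

text \<open>The exponent of \<open>s\<close> in the monomial \<open>D a\<^sub>0\<close>. It turns
  out to be the same for all homogeneous elements of the kernel of \<open>d\<close> that
  \<open>D\<close> does not kill.\<close>

private abbreviation k where "k \<equiv> nil_degree d (D a\<^sub>0)"

text \<open>\<open>D a * a\<^sub>0\<close> and \<open>D a\<^sub>0 * a\<close> have the same degree
  and are therefore proportional. Since \<open>a\<close> and \<open>a\<^sub>0\<close> have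
  \<open>d\<close>-degree zero, \<open>D a\<close> and \<open>D a\<^sub>0\<close> have equal
  \<open>d\<close>-degrees if \<open>D a \<noteq> 0\<close>, and \<open>slice_expansion\<close>
  applies.\<close>

lemma D_kernel_homogeneous:
  assumes "\<chi> \<in> carrier G" "a \<in> comp \<chi>" "d a = 0"
  obtains a' where "a' \<in> B" "d a' = 0" "D a = s ^ k * a'"
proof (cases "D a = 0")
  case True
  then show thesis
    using that[of 0] zero_closed derivation_zero[OF lnd_derivation[OF d]] by simp
next
  case False
  note derD = lnd_derivation[OF D] and derd = lnd_derivation[OF d]
  have B: "a \<in> B" "a\<^sub>0 \<in> B" using assms a\<^sub>0 comp_subset by auto
  have nz: "a \<noteq> 0" "a\<^sub>0 \<noteq> 0" using False a\<^sub>0(4) derivation_zero[OF derD] by auto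
  have DB: "D a \<in> B" "D a\<^sub>0 \<in> B" using B derivation_closed[OF derD] by auto
  have deg: "\<chi> \<otimes> e \<otimes> \<chi>\<^sub>0 = \<chi>\<^sub>0 \<otimes> e \<otimes> \<chi>"
    using assms(1) a\<^sub>0(1) e by (metis m_assoc m_comm m_closed)
  have "D a * a\<^sub>0 \<in> comp (\<chi>\<^sub>0 \<otimes> e \<otimes> \<chi>)" "D a\<^sub>0 * a \<in> comp (\<chi>\<^sub>0 \<otimes> e \<otimes> \<chi>)"
    using comp_mult[OF _ _ homogeneousD[OF D_hom assms(1,2)] a\<^sub>0(2)]
      comp_mult[OF _ _ homogeneousD[OF D_hom a\<^sub>0(1,2)] assms(2)] assms(1) a\<^sub>0(1) e deg
    by auto
  then obtain c where c: "D a\<^sub>0 * a = \<iota> c * (D a * a\<^sub>0)"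
    using comp_proportional[of "\<chi>\<^sub>0 \<otimes> e \<otimes> \<chi>"] mult_nonzero[OF DB(1) B(2) False nz(2)]
      assms(1) a\<^sub>0(1) e by blast
  have "c \<noteq> 0"
    using c mult_nonzero[OF DB(2) B(1) a\<^sub>0(4) nz(1)] by (auto simp: scalar_zero)
  then have "nil_degree d (D a\<^sub>0 * a) = nil_degree d (D a * a\<^sub>0)"
    unfolding c using DB B nz False
    by (intro nil_degree_scale[OF d]) (auto simp: mult_closed mult_nonzero)
  then have "nil_degree d (D a) = k"
    using nil_degree_mult[OF d] DB B nz False a\<^sub>0(3,4) assms(3) nil_degree_kernel[OF derd] by simp
  then show thesis
    using slice_expansion[OF _ homogeneousD[OF D_hom assms(1,2)] False] that assms(1) e by auto
qed

text \<open>The kernel of \<open>d\<close> is graded, so the homogeneous case applies to each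
  component.\<close>

lemma D_kernel:
  assumes "a \<in> B" "d a = 0"
  shows "\<exists>a'\<in>B. d a' = 0 \<and> D a = s ^ k * a'"
proof -
  note derD = lnd_derivation[OF D] and derd = lnd_derivation[OF d]
  have part: "\<exists>a'\<in>B. d a' = 0 \<and> D (part a \<chi>) = s ^ k * a'" if "\<chi> \<in> carrier G" for \<chi>
  proof -
    have "d (part a \<chi>) = 0"
      using homogeneous_part[OF derd d_hom _ assms(1) that] \<sigma> assms(2) by (simp add: part_zero)
    then show ?thesis
      using D_kernel_homogeneous[OF that part_comp[OF assms(1) that]] by metis
  qed
  then obtain p where p: "\<And>\<chi>. \<chi> \<in> carrier G \<Longrightarrow> p \<chi> \<in> B \<and> d (p \<chi>) = 0 \<and> D (part a \<chi>) = s ^ k * p \<chi>"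
    by metis
  let ?C = "{\<chi>. part a \<chi> \<noteq> 0}"
  have C: "?C \<subseteq> carrier G" by (rule part_support(2)[OF assms(1)])
  show ?thesis
  proof (intro bexI conjI)
    show "sum p ?C \<in> B" using p C by (intro sum_closed) auto
    show "d (sum p ?C) = 0" using p C by (subst derivation_sum[OF derd]) (auto intro!: sum.neutral)
    have "D a = (\<Sum>\<chi>\<in>?C. D (part a \<chi>))"
      using part_sum[OF assms(1) part_support(1)[OF assms(1)] order_refl]
        derivation_sum[OF derD, of ?C "part a"] part_closed[OF assms(1)] by simp
    also have "\<dots> = s ^ k * sum p ?C"
      unfolding sum_distrib_left using p C by (intro sum.cong) auto
    finally show "D a = s ^ k * sum p ?C" .
  qed
qed

text \<open>Division by \<open>s ^ k\<close> inside \<open>B\<close>. The coefficient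
  \<open>s ^ k - D s\<close> is the one for which the quotient at \<open>s\<close> becomes
  \<open>u\<close>; on the kernel of \<open>d\<close> the added term vanishes.\<close>

definition twist :: "'b \<Rightarrow> 'b" where
  "twist b = (THE c. c \<in> B \<and> s ^ k * c = D b + (s ^ k - D s) * d b)"

text \<open>\<open>s ^ k * d b\<close> is visibly divisible, which leaves
  \<open>D b - D s * d b\<close>. This is a derivation in \<open>b\<close> that kills
  \<open>s\<close>, so on a monomial \<open>s ^ i * a\<close> with \<open>d a = 0\<close> it gives
  \<open>s ^ i * D a\<close>, and \<open>D_kernel\<close> supplies the factor
  \<open>s ^ k\<close>.\<close>

lemma twist_exists:
  assumes "b \<in> B"
  shows "\<exists>c\<in>B. s ^ k * c = D b + (s ^ k - D s) * d b"
proof -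
  note derD = lnd_derivation[OF D] and derd = lnd_derivation[OF d]
  have "\<exists>c\<in>B. s ^ k * c = D b - D s * d b"
    using assms
  proof (induction rule: homogeneous_induct)
    case (homogeneous \<chi> b)
    show ?case
    proof (cases "b = 0")
      case True
      then have "s ^ k * 0 = D b - D s * d b"
        by (simp add: derivation_zero[OF derD] derivation_zero[OF derd])
      then show ?thesis using zero_closed by (rule bexI)
    next
      case False
      define \<Delta> where "\<Delta> = (\<lambda>b. D b - D s * d b)"
      have \<Delta>: "derivation \<Delta>"
        unfolding derivation_def \<Delta>_def
      proof (intro conjI ballI allI)
        fix a b c assume a: "a \<in> B"
        show "D a - D s * d a \<in> B"
          using a slice_closed derivation_closed[OF derD] derivation_closed[OF derd]
          by (intro diff_closed mult_closed) auto
        show "D (\<iota> c * a) - D s * d (\<iota> c * a) = \<iota> c * (D a - D s * d a)"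
          using a by (simp add: derivation_scale[OF derD] derivation_scale[OF derd] right_diff_distrib mult.left_commute)
        assume b: "b \<in> B"
        show "D (a + b) - D s * d (a + b) = D a - D s * d a + (D b - D s * d b)"
          using a b by (simp add: derivation_add[OF derD] derivation_add[OF derd] distrib_left)
        show "D (a * b) - D s * d (a * b) = (D a - D s * d a) * b + a * (D b - D s * d b)"
          using a b by (simp add: derivation_mult[OF derD] derivation_mult[OF derd] algebra_simps)
      qed
      have "\<Delta> s = 0"
        unfolding \<Delta>_def ds using unit_mult[OF derivation_closed[OF derD slice_closed]]
        by (simp add: mult.commute)
      obtain a where a: "a \<in> B" "d a = 0" "b = s ^ nil_degree d b * a"
        by (rule slice_expansion[OF homogeneous False])
      obtain a' where a': "a' \<in> B" "D a = s ^ k * a'"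
        using D_kernel[OF a(1,2)] by blast
      have "\<Delta> b = s ^ nil_degree d b * \<Delta> a"
        by (subst a(3)) (rule derivation_power_mult[OF \<Delta> slice_closed a(1) \<open>\<Delta> s = 0\<close>])
      also have "\<dots> = s ^ k * (s ^ nil_degree d b * a')"
        using a(2) a'(2) by (simp add: \<Delta>_def mult.left_commute)
      finally show ?thesis
        using power_mult_closed[OF slice_closed a'(1)] unfolding \<Delta>_def by (intro bexI) auto
    qed
  next
    case (add f g)
    from add.IH obtain x y where "x \<in> B" "s ^ k * x = D f - D s * d f"
      "y \<in> B" "s ^ k * y = D g - D s * d g" by auto
    then have "s ^ k * (x + y) = D (f + g) - D s * d (f + g)" "x + y \<in> B"
      using add.hyps by (simp_all add: derivation_add[OF derD] derivation_add[OF derd] distrib_left add_closed)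
    then show ?case by (rule bexI)
  qed
  then obtain c where "c \<in> B" "s ^ k * c = D b - D s * d b" by blast
  then have "s ^ k * (c + d b) = D b + (s ^ k - D s) * d b" "c + d b \<in> B"
    using derivation_closed[OF derd assms]
    by (simp_all add: distrib_left left_diff_distrib add_closed)
  then show ?thesis by (rule bexI)
qed

lemma twist:
  assumes "b \<in> B"
  shows "twist b \<in> B" "s ^ k * twist b = D b + (s ^ k - D s) * d b"
proof -
  have "\<exists>!c. c \<in> B \<and> s ^ k * c = D b + (s ^ k - D s) * d b"
  proof (rule ex_ex1I)
    show "\<exists>c. c \<in> B \<and> s ^ k * c = D b + (s ^ k - D s) * d b"
      using twist_exists[OF assms] by auto
    show "x = y" if "x \<in> B \<and> s ^ k * x = D b + (s ^ k - D s) * d b"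
      and "y \<in> B \<and> s ^ k * y = D b + (s ^ k - D s) * d b" for x y
      using that by (auto dest: power_mult_cancel[OF slice_closed slice_nonzero, of x y k])
  qed
  from theI'[OF this] show "twist b \<in> B" "s ^ k * twist b = D b + (s ^ k - D s) * d b"
    unfolding twist_def by auto
qed

text \<open>Cancellation of \<open>s ^ k\<close> allows identities for \<open>twist\<close> to be
  checked on the numerators.\<close>

lemma twist_eqI:
  assumes "b \<in> B" "c \<in> B" "s ^ k * c = D b + (s ^ k - D s) * d b"
  shows "twist b = c"
  by (rule power_mult_cancel[OF slice_closed slice_nonzero twist(1)[OF assms(1)] assms(2)])
    (rule trans[OF twist(2)[OF assms(1)] assms(3)[symmetric]])

lemma derivation_twist: "derivation twist"
  unfolding derivation_def
proof (intro conjI ballI allI)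
  note derD = lnd_derivation[OF D] and derd = lnd_derivation[OF d]
  fix a b c assume a: "a \<in> B"
  show "twist a \<in> B" by (rule twist(1)[OF a])
  show "twist (\<iota> c * a) = \<iota> c * twist a"
  proof (rule twist_eqI)
    have "s ^ k * (\<iota> c * twist a) = \<iota> c * (D a + (s ^ k - D s) * d a)"
      by (simp only: twist(2)[OF a, symmetric] mult.left_commute)
    also have "\<dots> = D (\<iota> c * a) + (s ^ k - D s) * d (\<iota> c * a)"
      unfolding derivation_scale[OF derD a] derivation_scale[OF derd a] by (simp add: algebra_simps)
    finally show "s ^ k * (\<iota> c * twist a) = D (\<iota> c * a) + (s ^ k - D s) * d (\<iota> c * a)" .
  qed (use a twist(1) in \<open>simp_all add: scale_closed\<close>)
  assume b: "b \<in> B"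
  show "twist (a + b) = twist a + twist b"
  proof (rule twist_eqI)
    have "s ^ k * (twist a + twist b) = D a + (s ^ k - D s) * d a + (D b + (s ^ k - D s) * d b)"
      by (simp only: distrib_left twist(2)[OF a] twist(2)[OF b])
    also have "\<dots> = D (a + b) + (s ^ k - D s) * d (a + b)"
      unfolding derivation_add[OF derD a b] derivation_add[OF derd a b] by (simp add: algebra_simps)
    finally show "s ^ k * (twist a + twist b) = D (a + b) + (s ^ k - D s) * d (a + b)" .
  qed (use a b twist(1) in \<open>simp_all add: add_closed\<close>)
  show "twist (a * b) = twist a * b + a * twist b"
  proof (rule twist_eqI)
    have "s ^ k * (twist a * b + a * twist b) = (s ^ k * twist a) * b + a * (s ^ k * twist b)"
      by (simp add: algebra_simps)
    also have "\<dots> = D (a * b) + (s ^ k - D s) * d (a * b)"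
      unfolding twist(2)[OF a] twist(2)[OF b] derivation_mult[OF derD a b] derivation_mult[OF derd a b]
      by (simp add: algebra_simps)
    finally show "s ^ k * (twist a * b + a * twist b) = D (a * b) + (s ^ k - D s) * d (a * b)" .
  qed (use a b twist(1) in \<open>simp_all add: mult_closed add_closed\<close>)
qed

lemma twist_slice: "twist s = u"
proof (rule twist_eqI)
  show "s ^ k * u = D s + (s ^ k - D s) * d s"
    using unit_mult[OF derivation_closed[OF lnd_derivation[OF D] slice_closed]]
    by (simp add: ds algebra_simps)
qed (auto simp: slice_closed unit_closed)

text \<open>The term with \<open>d\<close> drops out, and the quotient provided by
  \<open>D_kernel\<close> lies in the kernel of \<open>d\<close> again.\<close>

lemma twist_kernel:
  assumes "a \<in> B" "d a = 0"
  shows "d (twist a) = 0" "s ^ k * twist a = D a"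
proof -
  show eq: "s ^ k * twist a = D a" using twist(2)[OF assms(1)] assms(2) by simp
  obtain a' where "a' \<in> B" "d a' = 0" "D a = s ^ k * a'" using D_kernel[OF assms] by blast
  then show "d (twist a) = 0"
    using twist_eqI[OF assms(1), of a'] assms(2) by simp
qed

text \<open>\<open>D\<close> lowers the \<open>D\<close>-degree by one and division by
  \<open>s ^ k\<close> does not raise it, so the induction runs on the
  \<open>D\<close>-degree.\<close>

lemma twist_nilpotent_kernel:
  assumes "a \<in> B" "d a = 0"
  shows "\<exists>j. (twist ^^ j) a = 0"
  using assms
proof (induction "nil_degree D a" arbitrary: a rule: less_induct)
  case less
  show ?case
  proof (cases "twist a = 0")
    case True
    then have "(twist ^^ 1) a = 0" by simp
    then show ?thesis by blast
  next
    case False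
    note a = \<open>a \<in> B\<close> \<open>d a = 0\<close>
    have "D a \<noteq> 0"
      using twist_kernel(2)[OF a] power_mult_nonzero[OF slice_closed twist(1)[OF a(1)] slice_nonzero False]
      by metis
    then have "nil_degree D a = Suc (nil_degree D (s ^ k * twist a))"
      using nil_degree_derivation[OF D a(1)] twist_kernel(2)[OF a] by simp
    then have "nil_degree D (twist a) < nil_degree D a"
      using nil_degree_power_mult[OF D slice_closed twist(1)[OF a(1)] slice_nonzero False] by simp
    then obtain j where "(twist ^^ j) (twist a) = 0"
      using less.hyps twist(1)[OF a(1)] twist_kernel(1)[OF a] by blast
    then have "(twist ^^ Suc j) a = 0" by (simp add: funpow_swap1)
    then show ?thesis by blast
  qed
qed

text \<open>Sums of products \<open>s ^ i * a\<close> with \<open>d a = 0\<close> exhaust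
  \<open>B\<close>. Two applications kill \<open>s\<close>, the factor \<open>a\<close> is covered
  by \<open>twist_nilpotent_kernel\<close>, and nilpotency passes to products and sums.\<close>

lemma lnd_twist: "lnd twist"
  unfolding lnd_def
proof (intro conjI ballI)
  show der: "derivation twist" by (rule derivation_twist)
  have "(twist ^^ 2) s = 0"
    by (simp add: numeral_2_eq_2 twist_slice derivation_unit[OF der])
  then have s_nil: "\<exists>j. (twist ^^ j) s = 0" by blast
  fix b assume "b \<in> B"
  then show "\<exists>j. (twist ^^ j) b = 0"
  proof (induction rule: homogeneous_induct)
    case (homogeneous \<chi> b)
    show ?case
    proof (cases "b = 0")
      case True
      then show ?thesis using funpow_zero[OF der] by blast
    next
      case False
      obtain a where a: "a \<in> B" "d a = 0" "b = s ^ nil_degree d b * a"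
        by (rule slice_expansion[OF homogeneous False])
      have "\<exists>j. (twist ^^ j) (s ^ i * a) = 0" for i
      proof (induction i)
        case (Suc i)
        then show ?case
          using nilpotent_mult[OF der slice_closed power_mult_closed[OF slice_closed a(1)] s_nil]
          by (simp add: mult.assoc)
      qed (use twist_nilpotent_kernel[OF a(1,2)] in simp)
      then show ?thesis using a(3) by metis
    qed
  next
    case (add f g)
    then show ?case by (intro nilpotent_add[OF der])
  qed
qed

end

end

text \<open>The derivation \<open>d\<close> from \<open>homogeneous_slice\<close> has a slice, hence
  kills \<open>f\<close>, so that \<open>s ^ k\<close> times the twisted derivation at
  \<open>f\<close> is \<open>D f\<close>. The twisted derivation has a slice too and kills
  \<open>f\<close> as well.\<close>

theorem kernel_lnds_with_slice:
  assumes slice: "lnd D\<^sub>0" "s\<^sub>0 \<in> B" "D\<^sub>0 s\<^sub>0 = u" and f: "f \<in> B"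
    and ker: "\<And>E s. lnd E \<Longrightarrow> s \<in> B \<Longrightarrow> E s = u \<Longrightarrow> E f = 0"
    and D: "lnd D" "e \<in> carrier G" "homogeneous e D"
  shows "D f = 0"
proof (rule ccontr)
  assume Df: "D f \<noteq> 0"
  obtain d \<sigma> s where d: "lnd d" "\<sigma> \<in> carrier G" "homogeneous (inv \<sigma>) d" "s \<in> comp \<sigma>" "d s = u"
    using homogeneous_slice[OF slice] by blast
  note der = lnd_derivation[OF D(1)]
  have df: "d f = 0"
    by (rule ker[OF d(1) comp_subset[OF d(2,4)] d(5)])
  have "D f = (\<Sum>\<chi> | part f \<chi> \<noteq> 0. D (part f \<chi>))"
    using part_sum[OF f part_support(1)[OF f] order_refl]
      derivation_sum[OF der, of "{\<chi>. part f \<chi> \<noteq> 0}" "part f"] part_closed[OF f] by simp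
  then obtain \<chi> where \<chi>: "part f \<chi> \<noteq> 0" "D (part f \<chi>) \<noteq> 0"
    using Df by (metis (mono_tags, lifting) mem_Collect_eq sum.neutral)
  have \<chi>G: "\<chi> \<in> carrier G" using part_support(2)[OF f] \<chi>(1) by blast
  have "d (part f \<chi>) = 0"
    using homogeneous_part[OF lnd_derivation[OF d(1)] d(3) _ f \<chi>G] d(2) df by (simp add: part_zero)
  note twist_facts = d D \<chi>G part_comp[OF f \<chi>G] this \<chi>(2)
  \<comment> \<open>This component of \<open>f\<close> plays the role of \<open>a\<^sub>0\<close>
    and fixes the exponent of \<open>s\<close>.\<close>
  let ?E = "twist d s D (part f \<chi>)"
  have "?E f = 0"
    by (rule ker[OF lnd_twist[OF twist_facts] comp_subset[OF d(2,4)] twist_slice[OF twist_facts]])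
  then show False
    using twist_kernel(2)[OF twist_facts f df] Df by simp
qed

end

section \<open>Linear independence of characters\<close>

text \<open>Dedekind's argument: the relation at \<open>s \<otimes> t\<close> minus
  \<open>\<chi>\<^sub>0 s\<close> times the relation at \<open>t\<close> no longer contains
  \<open>\<chi>\<^sub>0\<close>. Extensionality makes distinct characters differ at some
  \<open>s\<close> in the group.\<close>

lemma (in group) characters_independent:
  fixes a :: "('a \<Rightarrow> 'k::field) \<Rightarrow> 'k"
  assumes "finite C"
    and "C \<subseteq> hom G multiplicative_group \<inter> extensional (carrier G)"
    and "\<And>t. t \<in> carrier G \<Longrightarrow> (\<Sum>\<chi>\<in>C. a \<chi> * \<chi> t) = 0"
    and "\<chi> \<in> C"
  shows "a \<chi> = 0"
  using assms
proof (induction C arbitrary: a \<chi> rule: finite_induct)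
  case (insert \<chi>\<^sub>0 C)
  have hom: "\<psi> (s \<otimes> t) = \<psi> s * \<psi> t"
    if "\<psi> \<in> insert \<chi>\<^sub>0 C" "s \<in> carrier G" "t \<in> carrier G" for \<psi> s t
    using insert.prems(1) that by (auto simp: hom_def multiplicative_group_def)
  have sum: "(\<Sum>\<psi>\<in>C. a \<psi> * \<psi> t) + a \<chi>\<^sub>0 * \<chi>\<^sub>0 t = 0" if "t \<in> carrier G" for t
    using insert.prems(2)[OF that] insert.hyps by (simp add: add.commute)
  have C: "a \<psi> = 0" if \<psi>: "\<psi> \<in> C" for \<psi>
  proof -
    have "\<psi> \<noteq> \<chi>\<^sub>0" using \<psi> insert.hyps by blast
    moreover have "\<psi> \<in> extensional (carrier G)" "\<chi>\<^sub>0 \<in> extensional (carrier G)"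
      using insert.prems(1) \<psi> by auto
    ultimately obtain s where s: "s \<in> carrier G" "\<psi> s \<noteq> \<chi>\<^sub>0 s"
      by (meson extensionalityI)
    have "a \<psi> * (\<psi> s - \<chi>\<^sub>0 s) = 0"
    proof (rule insert.IH[of "\<lambda>\<psi>. a \<psi> * (\<psi> s - \<chi>\<^sub>0 s)", OF _ _ \<psi>])
      show "C \<subseteq> hom G multiplicative_group \<inter> extensional (carrier G)"
        using insert.prems(1) by blast
      fix t assume t: "t \<in> carrier G"
      have "(\<Sum>\<eta>\<in>C. a \<eta> * (\<eta> s - \<chi>\<^sub>0 s) * \<eta> t)
          = (\<Sum>\<eta>\<in>C. a \<eta> * \<eta> (s \<otimes> t)) - \<chi>\<^sub>0 s * (\<Sum>\<eta>\<in>C. a \<eta> * \<eta> t)"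
        unfolding sum_distrib_left sum_subtractf[symmetric]
        using s t hom by (intro sum.cong) (auto simp: algebra_simps)
      also have "(\<Sum>\<eta>\<in>C. a \<eta> * \<eta> (s \<otimes> t)) = - (a \<chi>\<^sub>0 * (\<chi>\<^sub>0 s * \<chi>\<^sub>0 t))"
        using sum[of "s \<otimes> t"] hom[of \<chi>\<^sub>0 s t] s t by (simp add: eq_neg_iff_add_eq_0)
      also have "(\<Sum>\<eta>\<in>C. a \<eta> * \<eta> t) = - (a \<chi>\<^sub>0 * \<chi>\<^sub>0 t)"
        using sum[OF t] by (simp add: eq_neg_iff_add_eq_0)
      finally show "(\<Sum>\<eta>\<in>C. a \<eta> * (\<eta> s - \<chi>\<^sub>0 s) * \<eta> t) = 0"
        by (simp add: algebra_simps)
    qed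
    then show ?thesis using s by simp
  qed
  have "a \<chi>\<^sub>0 * \<chi>\<^sub>0 \<one> = 0"
    using sum[OF one_closed] C by simp
  moreover have "\<chi>\<^sub>0 \<one> \<noteq> 0"
    using insert.prems(1) one_closed by (auto simp: hom_def multiplicative_group_def)
  ultimately show ?case
    using C insert.prems(3) by auto
qed simp

section \<open>The character group of a torus\<close>

lemma comm_group_multiplicative_group: "comm_group (multiplicative_group :: 'k::field monoid)"
proof (rule comm_groupI)
  fix c :: 'k assume "c \<in> carrier multiplicative_group"
  then show "\<exists>d\<in>carrier multiplicative_group. d \<otimes>\<^bsub>multiplicative_group\<^esub> c = \<one>\<^bsub>multiplicative_group\<^esub>"
    by (intro bexI[of _ "inverse c"]) (auto simp: multiplicative_group_def)
qed (auto simp: multiplicative_group_def)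

lemma inv_multiplicative_group:
  fixes c :: "'k::field"
  assumes "c \<noteq> 0"
  shows "inv\<^bsub>multiplicative_group\<^esub> c = inverse c"
proof -
  interpret comm_group "multiplicative_group :: 'k monoid" by (rule comm_group_multiplicative_group)
  show ?thesis
    by (rule inv_equality) (use assms in \<open>auto simp: multiplicative_group_def\<close>)
qed

lemma group_multiplicative_group: "group (multiplicative_group :: 'k::field monoid)"
  using comm_group_multiplicative_group comm_group.axioms(2) by blast

lemma group_torus: "group (torus n :: (nat \<Rightarrow> 'k::field) monoid)"
  unfolding torus_def by (rule product_group) (rule group_multiplicative_group)

lemma carrier_torus: "carrier (torus n :: (nat \<Rightarrow> 'k::field) monoid) = {..<n} \<rightarrow>\<^sub>E UNIV - {0}"
  by (simp add: torus_def multiplicative_group_def)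

lemma mult_torus:
  "i < n \<Longrightarrow> (s \<otimes>\<^bsub>torus n\<^esub> t) i = s i * (t i :: 'k::field)"
  by (simp add: torus_def multiplicative_group_def)

lemma inv_torus:
  fixes t :: "nat \<Rightarrow> 'k::field"
  assumes "t \<in> carrier (torus n)" "i < n"
  shows "(inv\<^bsub>torus n\<^esub> t) i = inverse (t i)"
proof -
  have "t \<in> {..<n} \<rightarrow>\<^sub>E carrier multiplicative_group"
    using assms(1) by (simp add: torus_def)
  moreover have "t i \<noteq> 0"
    using assms by (auto simp: carrier_torus)
  ultimately show ?thesis
    using assms(2) by (simp add: torus_def group_multiplicative_group inv_multiplicative_group)
qed

text \<open>Inversion exchanges the generators \<open>t i\<close> and \<open>inverse (t i)\<close>.
  This makes the inverse of a character regular.\<close>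

lemma torus_functions_inv:
  fixes F :: "(nat \<Rightarrow> 'k::field) \<Rightarrow> 'k"
  assumes "F \<in> torus_functions n"
  shows "\<exists>F'\<in>torus_functions n. \<forall>t\<in>carrier (torus n). F (inv\<^bsub>torus n\<^esub> t) = F' t"
  using assms unfolding torus_functions_def
proof (induction rule: generated_functions.induct)
  case (gen g)
  then consider i where "i < n" "g = (\<lambda>t. t i)" | i where "i < n" "g = (\<lambda>t. inverse (t i))"
    by auto
  then show ?case
  proof cases
    case (1 i)
    then show ?thesis
      by (intro bexI[of _ "\<lambda>t. inverse (t i)"] generated_functions.gen) (auto simp: inv_torus)
  next
    case (2 i)
    then show ?thesis
      by (intro bexI[of _ "\<lambda>t. t i"] generated_functions.gen) (auto simp: inv_torus)
  qed
next
  case (const c)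
  show ?case by (rule bexI[OF _ generated_functions.const[of c]]) simp
next
  case (add f g)
  then obtain f' g' where
    "f' \<in> generated_functions ({\<lambda>t. t i |i. i < n} \<union> {\<lambda>t. inverse (t i) |i. i < n})"
    "\<forall>t\<in>carrier (torus n). f (inv\<^bsub>torus n\<^esub> t) = f' t"
    "g' \<in> generated_functions ({\<lambda>t. t i |i. i < n} \<union> {\<lambda>t. inverse (t i) |i. i < n})"
    "\<forall>t\<in>carrier (torus n). g (inv\<^bsub>torus n\<^esub> t) = g' t"
    by blast
  then show ?case by (intro bexI[OF _ generated_functions.add[of f' _ g']]) auto
next
  case (mult f g)
  then obtain f' g' where
    "f' \<in> generated_functions ({\<lambda>t. t i |i. i < n} \<union> {\<lambda>t. inverse (t i) |i. i < n})"
    "\<forall>t\<in>carrier (torus n). f (inv\<^bsub>torus n\<^esub> t) = f' t"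
    "g' \<in> generated_functions ({\<lambda>t. t i |i. i < n} \<union> {\<lambda>t. inverse (t i) |i. i < n})"
    "\<forall>t\<in>carrier (torus n). g (inv\<^bsub>torus n\<^esub> t) = g' t"
    by blast
  then show ?case by (intro bexI[OF _ generated_functions.mult[of f' _ g']]) auto
qed

lemma character_iff:
  "\<chi> \<in> carrier (character_group n :: ((nat \<Rightarrow> 'k::field) \<Rightarrow> 'k) monoid) \<longleftrightarrow>
    \<chi> \<in> extensional (carrier (torus n)) \<and>
    (\<forall>t\<in>carrier (torus n). \<chi> t \<noteq> 0) \<and>
    (\<forall>s\<in>carrier (torus n). \<forall>t\<in>carrier (torus n). \<chi> (s \<otimes>\<^bsub>torus n\<^esub> t) = \<chi> s * \<chi> t) \<and>
    (\<exists>F\<in>torus_functions n. \<forall>t\<in>carrier (torus n). \<chi> t = F t)"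
  by (auto simp: character_group_def hom_def multiplicative_group_def)

lemma character_hom:
  "\<chi> \<in> carrier (character_group n) \<Longrightarrow> s \<in> carrier (torus n) \<Longrightarrow> t \<in> carrier (torus n) \<Longrightarrow>
    \<chi> (s \<otimes>\<^bsub>torus n\<^esub> t) = \<chi> s * (\<chi> t :: 'k::field)"
  by (simp add: character_iff)

lemma mult_character_group:
  "t \<in> carrier (torus n) \<Longrightarrow> (\<chi> \<otimes>\<^bsub>character_group n\<^esub> \<psi>) t = \<chi> t * (\<psi> t :: 'k::field)"
  by (simp add: character_group_def)

lemma one_character_group:
  "t \<in> carrier (torus n) \<Longrightarrow> \<one>\<^bsub>character_group n\<^esub> t = (1 :: 'k::field)"
  by (simp add: character_group_def)

lemma character_one:
  assumes "\<chi> \<in> carrier (character_group n)"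
  shows "\<chi> \<one>\<^bsub>torus n\<^esub> = (1 :: 'k::field)"
proof -
  interpret T: group "torus n :: (nat \<Rightarrow> 'k) monoid" by (rule group_torus)
  have "\<chi> \<one>\<^bsub>torus n\<^esub> * \<chi> \<one>\<^bsub>torus n\<^esub> = \<chi> \<one>\<^bsub>torus n\<^esub>"
    using character_hom[OF assms T.one_closed T.one_closed] by simp
  moreover have "\<chi> \<one>\<^bsub>torus n\<^esub> \<noteq> 0"
    using assms T.one_closed unfolding character_iff by blast
  ultimately show ?thesis by simp
qed

lemma comm_group_character_group:
  "comm_group (character_group n :: ((nat \<Rightarrow> 'k::field) \<Rightarrow> 'k) monoid)"
proof -
  interpret T: group "torus n :: (nat \<Rightarrow> 'k) monoid" by (rule group_torus)
  let ?G = "character_group n :: ((nat \<Rightarrow> 'k) \<Rightarrow> 'k) monoid"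
  have ext: "\<chi> \<otimes>\<^bsub>?G\<^esub> \<psi> \<in> extensional (carrier (torus n))" "\<one>\<^bsub>?G\<^esub> \<in> extensional (carrier (torus n))"
    for \<chi> \<psi> by (simp_all add: character_group_def)
  have eqI: "\<chi> = \<psi>" if "\<chi> \<in> extensional (carrier (torus n))" "\<psi> \<in> extensional (carrier (torus n))"
    "\<And>t. t \<in> carrier (torus n) \<Longrightarrow> \<chi> t = \<psi> t" for \<chi> \<psi> :: "(nat \<Rightarrow> 'k) \<Rightarrow> 'k"
    using that by (rule extensionalityI)
  show ?thesis
  proof (rule comm_groupI)
    show "\<chi> \<otimes>\<^bsub>?G\<^esub> \<psi> \<in> carrier ?G" if "\<chi> \<in> carrier ?G" "\<psi> \<in> carrier ?G" for \<chi> \<psi>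
    proof -
      obtain F F' where "F \<in> torus_functions n" "F' \<in> torus_functions n"
        "\<forall>t\<in>carrier (torus n). \<chi> t = F t" "\<forall>t\<in>carrier (torus n). \<psi> t = F' t"
        using \<open>\<chi> \<in> carrier ?G\<close> \<open>\<psi> \<in> carrier ?G\<close> unfolding character_iff by blast
      then have "(\<lambda>t. F t * F' t) \<in> torus_functions n"
        "\<forall>t\<in>carrier (torus n). (\<chi> \<otimes>\<^bsub>?G\<^esub> \<psi>) t = F t * F' t"
        by (auto simp: torus_functions_def mult_character_group intro: generated_functions.mult)
      then have "\<exists>F\<in>torus_functions n. \<forall>t\<in>carrier (torus n). (\<chi> \<otimes>\<^bsub>?G\<^esub> \<psi>) t = F t"
        by (intro bexI[of _ "\<lambda>t. F t * F' t"])
      then show ?thesis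
        using that ext by (simp add: character_iff mult_character_group)
    qed
    have "(\<lambda>t. 1) \<in> (torus_functions n :: ((nat \<Rightarrow> 'k) \<Rightarrow> 'k) set)"
      by (simp add: torus_functions_def generated_functions.const)
    then show "\<one>\<^bsub>?G\<^esub> \<in> carrier ?G"
      using ext by (auto simp: character_iff one_character_group)
    show "\<exists>\<psi>\<in>carrier ?G. \<psi> \<otimes>\<^bsub>?G\<^esub> \<chi> = \<one>\<^bsub>?G\<^esub>" if \<chi>: "\<chi> \<in> carrier ?G" for \<chi>
    proof
      \<comment> \<open>The inverse character is the composition with inversion of the torus,
        restricted to remain extensional.\<close>
      let ?\<psi> = "\<lambda>t\<in>carrier (torus n). \<chi> (inv\<^bsub>torus n\<^esub> t)"
      obtain F where F: "F \<in> torus_functions n" "\<forall>t\<in>carrier (torus n). \<chi> t = F t"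
        using \<chi> unfolding character_iff by blast
      obtain F' where F': "F' \<in> torus_functions n"
        "\<forall>t\<in>carrier (torus n). F (inv\<^bsub>torus n\<^esub> t) = F' t"
        using torus_functions_inv[OF F(1)] by blast
      have "\<chi> (inv\<^bsub>torus n\<^esub> (s \<otimes>\<^bsub>torus n\<^esub> t)) = \<chi> (inv\<^bsub>torus n\<^esub> s) * \<chi> (inv\<^bsub>torus n\<^esub> t)"
        if "s \<in> carrier (torus n)" "t \<in> carrier (torus n)" for s t
        using that character_hom[OF \<chi>] by (simp add: T.inv_mult_group mult.commute)
      then show "?\<psi> \<in> carrier ?G"
        using \<chi> F F' unfolding character_iff by auto
      have "\<chi> (inv\<^bsub>torus n\<^esub> t) * \<chi> t = 1" if t: "t \<in> carrier (torus n)" for t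
        using character_hom[OF \<chi> T.inv_closed[OF t] t] character_one[OF \<chi>] t by simp
      then show "?\<psi> \<otimes>\<^bsub>?G\<^esub> \<chi> = \<one>\<^bsub>?G\<^esub>"
        by (intro eqI ext) (simp add: mult_character_group one_character_group)
    qed
  next
    fix \<chi> assume \<chi>: "\<chi> \<in> carrier ?G"
    show "\<one>\<^bsub>?G\<^esub> \<otimes>\<^bsub>?G\<^esub> \<chi> = \<chi>"
      using \<chi> by (intro eqI ext) (simp_all add: mult_character_group one_character_group character_iff)
  qed (intro eqI ext; simp add: mult_character_group mult_ac)+
qed

lemma torus_characters_independent:
  fixes a :: "((nat \<Rightarrow> 'k::field) \<Rightarrow> 'k) \<Rightarrow> 'k"
  assumes "finite C" "C \<subseteq> carrier (character_group n)"
    and "\<And>t. t \<in> carrier (torus n) \<Longrightarrow> (\<Sum>\<chi>\<in>C. a \<chi> * \<chi> t) = 0" "\<chi> \<in> C"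
  shows "a \<chi> = 0"
  using assms(2) by (intro group.characters_independent[OF group_torus assms(1) _ assms(3,4)])
    (auto simp: character_group_def)

section \<open>Weight expansions of functions on a torus times an affine space\<close>

text \<open>Membership in the tensor product of the coordinate rings of torus and affine space,
  written out over the characters.\<close>

definition weight_expansion ::
    "nat \<Rightarrow> nat \<Rightarrow> ((nat \<Rightarrow> 'k::field) \<Rightarrow> (nat \<Rightarrow> 'k) \<Rightarrow> 'k) \<Rightarrow> bool" where
  "weight_expansion n m F \<longleftrightarrow> (\<exists>C g. finite C \<and> C \<subseteq> carrier (character_group n) \<and>
     (\<forall>\<chi>\<in>C. g \<chi> \<in> polynomial_functions m) \<and>
     (\<forall>t\<in>carrier (torus n). \<forall>x. F t x = (\<Sum>\<chi>\<in>C. \<chi> t * g \<chi> x)))"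

lemma weight_expansion_term:
  assumes "\<chi> \<in> carrier (character_group n)" "p \<in> polynomial_functions m"
  shows "weight_expansion n m (\<lambda>t x. \<chi> t * p x)"
  unfolding weight_expansion_def
  using assms by (intro exI[of _ "{\<chi>}"] exI[of _ "\<lambda>_. p"]) auto

lemma weight_expansion_cong:
  assumes "weight_expansion n m F" "\<And>t x. t \<in> carrier (torus n) \<Longrightarrow> F' t x = F t x"
  shows "weight_expansion n m F'"
  using assms unfolding weight_expansion_def by simp

lemma weight_expansion_add:
  assumes "weight_expansion n m F" "weight_expansion n m F'"
  shows "weight_expansion n m (\<lambda>t x. F t x + F' t x)"
proof -
  obtain C g where C: "finite C" "C \<subseteq> carrier (character_group n)"
    "\<forall>\<chi>\<in>C. g \<chi> \<in> polynomial_functions m"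
    "\<forall>t\<in>carrier (torus n). \<forall>x. F t x = (\<Sum>\<chi>\<in>C. \<chi> t * g \<chi> x)"
    using assms(1) unfolding weight_expansion_def by blast
  obtain C' g' where C': "finite C'" "C' \<subseteq> carrier (character_group n)"
    "\<forall>\<chi>\<in>C'. g' \<chi> \<in> polynomial_functions m"
    "\<forall>t\<in>carrier (torus n). \<forall>x. F' t x = (\<Sum>\<chi>\<in>C'. \<chi> t * g' \<chi> x)"
    using assms(2) unfolding weight_expansion_def by blast
  \<comment> \<open>Coefficients are extended by zero so that both expansions run over
    \<open>C \<union> C'\<close>.\<close>
  define h where "h = (\<lambda>\<chi>. if \<chi> \<in> C then g \<chi> else (\<lambda>x. 0))"
  define h' where "h' = (\<lambda>\<chi>. if \<chi> \<in> C' then g' \<chi> else (\<lambda>x. 0))"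
  have zero: "(\<lambda>x. 0) \<in> polynomial_functions m"
    by (simp add: polynomial_functions_def generated_functions.const)
  have h: "h \<chi> \<in> polynomial_functions m" "h' \<chi> \<in> polynomial_functions m" for \<chi>
    using C(3) C'(3) zero by (auto simp: h_def h'_def)
  have "F t x + F' t x = (\<Sum>\<chi>\<in>C \<union> C'. \<chi> t * (h \<chi> x + h' \<chi> x))" if "t \<in> carrier (torus n)" for t x
  proof -
    have "F t x = (\<Sum>\<chi>\<in>C. \<chi> t * h \<chi> x)"
      using C(4) that by (auto simp: h_def intro: sum.cong)
    also have "\<dots> = (\<Sum>\<chi>\<in>C \<union> C'. \<chi> t * h \<chi> x)"
      using C(1) C'(1) by (intro sum.mono_neutral_left) (auto simp: h_def)
    finally have F: "F t x = (\<Sum>\<chi>\<in>C \<union> C'. \<chi> t * h \<chi> x)" .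
    have "F' t x = (\<Sum>\<chi>\<in>C'. \<chi> t * h' \<chi> x)"
      using C'(4) that by (auto simp: h'_def intro: sum.cong)
    also have "\<dots> = (\<Sum>\<chi>\<in>C \<union> C'. \<chi> t * h' \<chi> x)"
      using C(1) C'(1) by (intro sum.mono_neutral_left) (auto simp: h'_def)
    finally show ?thesis using F by (simp add: sum.distrib distrib_left)
  qed
  moreover have "(\<lambda>x. h \<chi> x + h' \<chi> x) \<in> polynomial_functions m" for \<chi>
    using h unfolding polynomial_functions_def by (intro generated_functions.add)
  ultimately show ?thesis
    unfolding weight_expansion_def using C(1,2) C'(1,2)
    by (intro exI[of _ "C \<union> C'"] exI[of _ "\<lambda>\<chi> x. h \<chi> x + h' \<chi> x"]) auto
qed

lemma weight_expansion_sum: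
  assumes "\<And>i. i \<in> I \<Longrightarrow> weight_expansion n m (F i)"
  shows "weight_expansion n m (\<lambda>t x. \<Sum>i\<in>I. F i t x)"
proof -
  have "weight_expansion n m (\<lambda>t x. 0)"
    unfolding weight_expansion_def by (intro exI[of _ "{}"]) auto
  then show ?thesis
    using assms by (induction I rule: infinite_finite_induct) (auto intro: weight_expansion_add)
qed

lemma weight_expansion_mult:
  fixes F F' :: "(nat \<Rightarrow> 'k::field) \<Rightarrow> (nat \<Rightarrow> 'k) \<Rightarrow> 'k"
  assumes "weight_expansion n m F" "weight_expansion n m F'"
  shows "weight_expansion n m (\<lambda>t x. F t x * F' t x)"
proof -
  interpret G: comm_group "character_group n :: ((nat \<Rightarrow> 'k) \<Rightarrow> 'k) monoid"
    by (rule comm_group_character_group)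
  obtain C g where C: "finite C" "C \<subseteq> carrier (character_group n)"
    "\<forall>\<chi>\<in>C. g \<chi> \<in> polynomial_functions m"
    "\<forall>t\<in>carrier (torus n). \<forall>x. F t x = (\<Sum>\<chi>\<in>C. \<chi> t * g \<chi> x)"
    using assms(1) unfolding weight_expansion_def by blast
  obtain C' g' where C': "finite C'" "C' \<subseteq> carrier (character_group n)"
    "\<forall>\<chi>\<in>C'. g' \<chi> \<in> polynomial_functions m"
    "\<forall>t\<in>carrier (torus n). \<forall>x. F' t x = (\<Sum>\<chi>\<in>C'. \<chi> t * g' \<chi> x)"
    using assms(2) unfolding weight_expansion_def by blast
  have "weight_expansion n m
      (\<lambda>t x. \<Sum>\<chi>\<in>C. \<Sum>\<psi>\<in>C'. (\<chi> \<otimes>\<^bsub>character_group n\<^esub> \<psi>) t * (g \<chi> x * g' \<psi> x))"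
    using C C'
    by (intro weight_expansion_sum weight_expansion_term)
      (auto simp: polynomial_functions_def intro: generated_functions.mult)
  then show ?thesis
  proof (rule weight_expansion_cong)
    fix t x :: "nat \<Rightarrow> 'k" assume t: "t \<in> carrier (torus n)"
    have "F t x * F' t x = (\<Sum>\<chi>\<in>C. \<Sum>\<psi>\<in>C'. (\<chi> t * g \<chi> x) * (\<psi> t * g' \<psi> x))"
      using C(4) C'(4) t by (simp add: sum_product)
    also have "\<dots> = (\<Sum>\<chi>\<in>C. \<Sum>\<psi>\<in>C'. (\<chi> \<otimes>\<^bsub>character_group n\<^esub> \<psi>) t * (g \<chi> x * g' \<psi> x))"
      using t by (intro sum.cong refl) (simp add: mult_character_group mult_ac)
    finally show "F t x * F' t x =
      (\<Sum>\<chi>\<in>C. \<Sum>\<psi>\<in>C'. (\<chi> \<otimes>\<^bsub>character_group n\<^esub> \<psi>) t * (g \<chi> x * g' \<psi> x))" .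
  qed
qed

text \<open>The torus coordinates and their inverses are characters, the affine coordinates have
  trivial weight, and expansions are closed under sums and products.\<close>

lemma weight_expansion_torus_affine:
  fixes F :: "(nat \<Rightarrow> 'k::field) \<times> (nat \<Rightarrow> 'k) \<Rightarrow> 'k"
  assumes "F \<in> torus_affine_functions n m"
  shows "weight_expansion n m (\<lambda>t x. F (t, x))"
proof -
  interpret T: group "torus n :: (nat \<Rightarrow> 'k) monoid" by (rule group_torus)
  interpret G: comm_group "character_group n :: ((nat \<Rightarrow> 'k) \<Rightarrow> 'k) monoid"
    by (rule comm_group_character_group)
  have const_poly: "(\<lambda>x. c) \<in> polynomial_functions m" for c :: 'k
    by (simp add: polynomial_functions_def generated_functions.const)
  have poly: "weight_expansion n m (\<lambda>t x. p x)" if "p \<in> polynomial_functions m"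
    for p :: "(nat \<Rightarrow> 'k) \<Rightarrow> 'k"
    by (rule weight_expansion_cong[OF weight_expansion_term[OF G.one_closed that]])
      (simp add: one_character_group)
  have char: "weight_expansion n m (\<lambda>t x. F t)"
    if F: "F \<in> torus_functions n" "\<And>t. t \<in> carrier (torus n) \<Longrightarrow> F t \<noteq> 0"
      "\<And>s t. s \<in> carrier (torus n) \<Longrightarrow> t \<in> carrier (torus n) \<Longrightarrow> F (s \<otimes>\<^bsub>torus n\<^esub> t) = F s * F t"
    for F :: "(nat \<Rightarrow> 'k) \<Rightarrow> 'k"
  proof (rule weight_expansion_cong)
    have "restrict F (carrier (torus n)) \<in> carrier (character_group n)"
      unfolding character_iff using F by (auto intro: bexI[of _ F])
    from weight_expansion_term[OF this const_poly[of 1]]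
    show "weight_expansion n m (\<lambda>t x. restrict F (carrier (torus n)) t * 1)" .
  qed simp
  show ?thesis
    using assms unfolding torus_affine_functions_def
  proof (induction rule: generated_functions.induct)
    case (gen g)
    then consider i where "i < n" "g = (\<lambda>(t, x). t i)"
      | i where "i < n" "g = (\<lambda>(t, x). inverse (t i))"
      | j where "j < m" "g = (\<lambda>(t, x). x j)"
      by auto
    then show ?case
    proof cases
      case (1 i)
      have "weight_expansion n m (\<lambda>t x. t i :: 'k)"
        using \<open>i < n\<close>
        by (intro char) (auto simp: torus_functions_def mult_torus carrier_torus
            intro: generated_functions.gen)
      then show ?thesis using 1 by simp
    next
      case (2 i)
      have "weight_expansion n m (\<lambda>t x. inverse (t i) :: 'k)"
        using \<open>i < n\<close>
        by (intro char) (auto simp: torus_functions_def mult_torus carrier_torus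
            intro: generated_functions.gen)
      then show ?thesis using 2 by simp
    next
      case (3 j)
      have "weight_expansion n m (\<lambda>t x. x j :: 'k)"
        using \<open>j < m\<close> by (intro poly) (auto simp: polynomial_functions_def intro: generated_functions.gen)
      then show ?thesis using 3 by simp
    qed
  next
    case (const c)
    show ?case by (rule poly[OF const_poly])
  next
    case (add f g)
    then show ?case by (intro weight_expansion_add)
  next
    case (mult f g)
    then show ?case by (intro weight_expansion_mult)
  qed
qed

section \<open>The coordinate ring of an affine toric variety\<close>

lemma carrier_regular_functions:
  "carrier (regular_functions m X) =
    {(\<lambda>x. if x \<in> X then p x else 0) | p. p \<in> polynomial_functions m}"
  by (simp add: regular_functions_def)

lemma regular_functions_simps:
  "f \<oplus>\<^bsub>regular_functions m X\<^esub> g = f + g"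
  "f \<otimes>\<^bsub>regular_functions m X\<^esub> g = f * g"
  "c \<odot>\<^bsub>regular_functions m X\<^esub> f = (\<lambda>_. c) * f"
  "\<zero>\<^bsub>regular_functions m X\<^esub> = 0"
  "\<one>\<^bsub>regular_functions m X\<^esub> = (\<lambda>x. if x \<in> X then 1 else 0)"
  by (auto simp: regular_functions_def)

lemma regular_functionE:
  assumes "f \<in> carrier (regular_functions m X)"
  obtains p where "p \<in> polynomial_functions m" "f = (\<lambda>x. if x \<in> X then p x else 0)"
  using assms by (auto simp: carrier_regular_functions)

lemma regular_functionI:
  "p \<in> polynomial_functions m \<Longrightarrow> (\<And>x. x \<in> X \<Longrightarrow> f x = p x) \<Longrightarrow> (\<And>x. x \<notin> X \<Longrightarrow> f x = 0) \<Longrightarrow>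
    f \<in> carrier (regular_functions m X)"
  unfolding carrier_regular_functions by (intro CollectI exI[of _ p]) auto

lemma regular_function_outside:
  "f \<in> carrier (regular_functions m X) \<Longrightarrow> x \<notin> X \<Longrightarrow> f x = 0"
  by (auto simp: carrier_regular_functions)

lemma regular_functions_add:
  assumes "f \<in> carrier (regular_functions m X)" "g \<in> carrier (regular_functions m X)"
  shows "f + g \<in> carrier (regular_functions m X)"
proof -
  obtain p q where "p \<in> polynomial_functions m" "f = (\<lambda>x. if x \<in> X then p x else 0)"
    "q \<in> polynomial_functions m" "g = (\<lambda>x. if x \<in> X then q x else 0)"
    using assms by (elim regular_functionE)
  then show ?thesis
    unfolding polynomial_functions_def
    by (intro regular_functionI[of "\<lambda>x. p x + q x"])
      (auto simp: polynomial_functions_def intro: generated_functions.add)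
qed

lemma regular_functions_mult:
  assumes "f \<in> carrier (regular_functions m X)" "g \<in> carrier (regular_functions m X)"
  shows "f * g \<in> carrier (regular_functions m X)"
proof -
  obtain p q where "p \<in> polynomial_functions m" "f = (\<lambda>x. if x \<in> X then p x else 0)"
    "q \<in> polynomial_functions m" "g = (\<lambda>x. if x \<in> X then q x else 0)"
    using assms by (elim regular_functionE)
  then show ?thesis
    unfolding polynomial_functions_def
    by (intro regular_functionI[of "\<lambda>x. p x * q x"])
      (auto simp: polynomial_functions_def intro: generated_functions.mult)
qed

lemma regular_functions_scale:
  assumes "f \<in> carrier (regular_functions m X)"
  shows "(\<lambda>_. c) * f \<in> carrier (regular_functions m X)"
proof -
  obtain p where "p \<in> polynomial_functions m" "f = (\<lambda>x. if x \<in> X then p x else 0)"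
    using assms by (elim regular_functionE)
  then show ?thesis
    unfolding polynomial_functions_def
    by (intro regular_functionI[of "\<lambda>x. c * p x"])
      (auto simp: polynomial_functions_def intro: generated_functions.mult generated_functions.const)
qed

lemma regular_functions_const:
  "(\<lambda>x. if x \<in> X then c else 0) \<in> carrier (regular_functions m X)"
  by (rule regular_functionI[of "\<lambda>_. c"])
    (auto simp: polynomial_functions_def generated_functions.const)

text \<open>\<open>X\<close> is covered by \<open>Z\<close> and the zero set of a polynomial
  representing \<open>f\<close>, and irreducibility picks one of the two. It is used as density of
  nonempty open subsets.\<close>

lemma irreducible_subset_zeros:
  assumes X: "irreducible_affine_variety m X" and "zariski_closed m Z"
    and f: "f \<in> carrier (regular_functions m X)" and "\<And>x. x \<in> X \<Longrightarrow> x \<notin> Z \<Longrightarrow> f x = 0"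
  shows "X \<subseteq> Z \<or> f = 0"
proof -
  obtain p where p: "p \<in> polynomial_functions m" "f = (\<lambda>x. if x \<in> X then p x else 0)"
    using f by (rule regular_functionE)
  have "X \<subseteq> affine_space m"
    using X by (auto simp: irreducible_affine_variety_def zariski_closed_def)
  then have "X \<subseteq> Z \<union> {x \<in> affine_space m. p x = 0}"
    using assms(4) p by fastforce
  moreover have "zariski_closed m {x \<in> affine_space m. p x = 0}"
    unfolding zariski_closed_def using p by (intro exI[of _ "{p}"]) auto
  ultimately have "X \<subseteq> Z \<or> X \<subseteq> {x \<in> affine_space m. p x = 0}"
    using X assms(2) unfolding irreducible_affine_variety_def by blast
  then show ?thesis
  proof
    assume "X \<subseteq> {x \<in> affine_space m. p x = 0}"
    then have "f x = 0" for x using p(2) by auto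
    then show ?thesis by (simp add: fun_eq_iff)
  qed simp
qed

text \<open>\<open>g\<close> vanishes wherever \<open>f\<close> does not, so
  \<open>irreducible_subset_zeros\<close> applies with the zero set of \<open>f\<close> as
  \<open>Z\<close>.\<close>

lemma regular_functions_no_zero_divisors:
  assumes X: "irreducible_affine_variety m X"
    and f: "f \<in> carrier (regular_functions m X)" and g: "g \<in> carrier (regular_functions m X)"
    and "f * g = 0"
  shows "f = 0 \<or> g = 0"
proof -
  obtain p where p: "p \<in> polynomial_functions m" "f = (\<lambda>x. if x \<in> X then p x else 0)"
    using f by (rule regular_functionE)
  have fg: "f x = 0 \<or> g x = 0" for x
    using fun_cong[OF \<open>f * g = 0\<close>, of x] by simp
  have "X \<subseteq> affine_space m"
    using X by (auto simp: irreducible_affine_variety_def zariski_closed_def)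
  have "zariski_closed m {x \<in> affine_space m. p x = 0}"
    unfolding zariski_closed_def using p by (intro exI[of _ "{p}"]) auto
  then have "X \<subseteq> {x \<in> affine_space m. p x = 0} \<or> g = 0"
  proof (rule irreducible_subset_zeros[OF X _ g])
    show "g x = 0" if "x \<in> X" "x \<notin> {x \<in> affine_space m. p x = 0}" for x
      using that fg[of x] p(2) \<open>X \<subseteq> affine_space m\<close> by auto
  qed
  then show ?thesis
  proof
    assume "X \<subseteq> {x \<in> affine_space m. p x = 0}"
    then have "f x = 0" for x using p(2) by auto
    then show ?thesis by (simp add: fun_eq_iff)
  qed simp
qed

lemma sum_fun_apply: "(\<Sum>i\<in>I. f i) x = (\<Sum>i\<in>I. f i x)"
  by (induction I rule: infinite_finite_induct) auto

context
  fixes X :: "(nat \<Rightarrow> 'k::field_char_0) set"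
    and \<phi> :: "(nat \<Rightarrow> 'k) \<Rightarrow> (nat \<Rightarrow> 'k) \<Rightarrow> (nat \<Rightarrow> 'k)"
    and n m :: nat
  assumes toric: "affine_toric_variety n m X \<phi>"
begin

private abbreviation "K_X \<equiv> regular_functions m X"

lemma irreducible: "irreducible_affine_variety m X"
  and action: "group_action (torus n) X \<phi>"
  and algebraic: "\<forall>j<m. \<exists>F\<in>torus_affine_functions n m.
        \<forall>t\<in>carrier (torus n). \<forall>x\<in>X. \<phi> t x j = F (t, x)"
  using toric by (auto simp: affine_toric_variety_def algebraic_torus_action_def)

lemma action_closed: "t \<in> carrier (torus n) \<Longrightarrow> x \<in> X \<Longrightarrow> \<phi> t x \<in> X"
  using group_action.element_image[OF action] by blast

text \<open>The comorphism of the action: substitution of the coordinates of \<open>\<phi>\<close>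
  into \<open>p\<close> gives a regular function on the torus times affine space, which has a weight
  expansion.\<close>

lemma action_weight_expansion:
  assumes "p \<in> polynomial_functions m"
  shows "\<exists>C g. finite C \<and> C \<subseteq> carrier (character_group n) \<and>
    (\<forall>\<chi>\<in>C. g \<chi> \<in> polynomial_functions m) \<and>
    (\<forall>t\<in>carrier (torus n). \<forall>x\<in>X. p (\<phi> t x) = (\<Sum>\<chi>\<in>C. \<chi> t * g \<chi> x))"
proof -
  have "\<exists>F\<in>torus_affine_functions n m. \<forall>t\<in>carrier (torus n). \<forall>x\<in>X. p (\<phi> t x) = F (t, x)"
    using assms unfolding polynomial_functions_def
  proof (induction rule: generated_functions.induct)
    case (gen g)
    then show ?case using algebraic by auto
  next
    case (const c)
    show ?case
      by (rule bexI[of _ "\<lambda>_. c"]) (auto simp: torus_affine_functions_def generated_functions.const)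
  next
    case (add f g)
    then obtain F G where "F \<in> torus_affine_functions n m" "G \<in> torus_affine_functions n m"
      "\<forall>t\<in>carrier (torus n). \<forall>x\<in>X. f (\<phi> t x) = F (t, x)"
      "\<forall>t\<in>carrier (torus n). \<forall>x\<in>X. g (\<phi> t x) = G (t, x)" by auto
    then show ?case
      by (intro bexI[of _ "\<lambda>z. F z + G z"])
        (auto simp: torus_affine_functions_def intro: generated_functions.add)
  next
    case (mult f g)
    then obtain F G where "F \<in> torus_affine_functions n m" "G \<in> torus_affine_functions n m"
      "\<forall>t\<in>carrier (torus n). \<forall>x\<in>X. f (\<phi> t x) = F (t, x)"
      "\<forall>t\<in>carrier (torus n). \<forall>x\<in>X. g (\<phi> t x) = G (t, x)" by auto
    then show ?case
      by (intro bexI[of _ "\<lambda>z. F z * G z"])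
        (auto simp: torus_affine_functions_def intro: generated_functions.mult)
  qed
  then obtain F where F: "F \<in> torus_affine_functions n m"
    "\<forall>t\<in>carrier (torus n). \<forall>x\<in>X. p (\<phi> t x) = F (t, x)" by blast
  obtain C g where "finite C" "C \<subseteq> carrier (character_group n)"
    "\<forall>\<chi>\<in>C. g \<chi> \<in> polynomial_functions m"
    "\<forall>t\<in>carrier (torus n). \<forall>x. F (t, x) = (\<Sum>\<chi>\<in>C. \<chi> t * g \<chi> x)"
    using weight_expansion_torus_affine[OF F(1)] unfolding weight_expansion_def by blast
  then show ?thesis
    using F(2) by (intro exI[of _ C] exI[of _ g]) auto
qed

section \<open>Weight decomposition of the coordinate ring\<close>

lemma graded_componentD:
  assumes "f \<in> graded_component n m X \<phi> \<chi>"
  shows "f \<in> carrier K_X" "t \<in> carrier (torus n) \<Longrightarrow> x \<in> X \<Longrightarrow> f (\<phi> t x) = \<chi> t * f x"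
  using assms by (auto simp: graded_component_def)

text \<open>The components are the coefficients in the weight expansion of
  \<open>p (\<phi> t x)\<close>. Expanding at the product of \<open>t\<close> and \<open>s\<close>
  in two ways and comparing coefficients of characters in \<open>t\<close> shows that they are
  semi-invariant.\<close>

lemma graded_components_span:
  assumes "f \<in> carrier K_X"
  shows "\<exists>C g. finite C \<and> C \<subseteq> carrier (character_group n) \<and>
    (\<forall>\<chi>\<in>C. g \<chi> \<in> graded_component n m X \<phi> \<chi>) \<and> f = (\<Sum>\<chi>\<in>C. g \<chi>)"
proof -
  interpret A: group_action "torus n" X \<phi> by (rule action)
  interpret T: group "torus n :: (nat \<Rightarrow> 'k) monoid" by (rule group_torus)
  obtain p where p: "p \<in> polynomial_functions m" "f = (\<lambda>x. if x \<in> X then p x else 0)"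
    using assms by (rule regular_functionE)
  obtain C g where C: "finite C" "C \<subseteq> carrier (character_group n)"
    "\<forall>\<chi>\<in>C. g \<chi> \<in> polynomial_functions m"
    and g: "\<And>t x. t \<in> carrier (torus n) \<Longrightarrow> x \<in> X \<Longrightarrow> p (\<phi> t x) = (\<Sum>\<chi>\<in>C. \<chi> t * g \<chi> x)"
    using action_weight_expansion[OF p(1)] by blast
  define h where "h = (\<lambda>\<chi> x. if x \<in> X then g \<chi> x else 0)"
  have "h \<chi> \<in> graded_component n m X \<phi> \<chi>" if \<chi>: "\<chi> \<in> C" for \<chi>
  proof -
    have "g \<chi> (\<phi> s x) = \<chi> s * g \<chi> x" if s: "s \<in> carrier (torus n)" and x: "x \<in> X" for s x
    proof -
      have "\<chi> s * g \<chi> x - g \<chi> (\<phi> s x) = 0"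
      proof (rule torus_characters_independent[OF C(1,2) _ \<chi>,
            of "\<lambda>\<chi>. \<chi> s * g \<chi> x - g \<chi> (\<phi> s x)"])
        fix t :: "nat \<Rightarrow> 'k" assume t: "t \<in> carrier (torus n)"
        have "(\<Sum>\<chi>\<in>C. \<chi> t * g \<chi> (\<phi> s x)) = p (\<phi> (t \<otimes>\<^bsub>torus n\<^esub> s) x)"
          using g[OF t action_closed[OF s x]] A.composition_rule[OF x t s] by simp
        also have "\<dots> = (\<Sum>\<chi>\<in>C. \<chi> (t \<otimes>\<^bsub>torus n\<^esub> s) * g \<chi> x)"
          using g[OF T.m_closed[OF t s] x] .
        also have "\<dots> = (\<Sum>\<chi>\<in>C. \<chi> t * (\<chi> s * g \<chi> x))"
          using C(2) t s by (intro sum.cong) (auto simp: character_hom)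
        finally have "(\<Sum>\<chi>\<in>C. \<chi> t * (\<chi> s * g \<chi> x) - \<chi> t * g \<chi> (\<phi> s x)) = 0"
          by (simp add: sum_subtractf)
        then show "(\<Sum>\<chi>\<in>C. (\<chi> s * g \<chi> x - g \<chi> (\<phi> s x)) * \<chi> t) = 0"
          by (simp add: right_diff_distrib mult.commute)
      qed
      then show ?thesis by simp
    qed
    moreover have "h \<chi> \<in> carrier K_X"
      using C(3) \<chi> by (intro regular_functionI[of "g \<chi>"]) (auto simp: h_def)
    ultimately show ?thesis
      by (auto simp: graded_component_def h_def action_closed)
  qed
  moreover have "f = (\<Sum>\<chi>\<in>C. h \<chi>)"
  proof
    fix x
    show "f x = (\<Sum>\<chi>\<in>C. h \<chi>) x"
    proof (cases "x \<in> X")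
      case True
      \<comment> \<open>At the unit of the torus all characters take the value one, so the
        coefficients add up to \<open>p\<close> on \<open>X\<close>.\<close>
      have "\<phi> \<one>\<^bsub>torus n\<^esub> x = x"
        using fun_cong[OF A.id_eq_one, of x] True by simp
      then have "p x = (\<Sum>\<chi>\<in>C. \<chi> \<one>\<^bsub>torus n\<^esub> * g \<chi> x)"
        using g[OF T.one_closed True] by simp
      also have "\<dots> = (\<Sum>\<chi>\<in>C. g \<chi> x)"
        using C(2) by (intro sum.cong) (auto simp: character_one)
      finally show ?thesis using True by (simp add: p(2) h_def sum_fun_apply)
    next
      case False
      then show ?thesis by (simp add: p(2) h_def sum_fun_apply)
    qed
  qed
  ultimately show ?thesis using C(1,2) by blast
qed

text \<open>Evaluation at the points \<open>\<phi> t x\<close> turns the relation into one between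
  characters, with coefficients \<open>g \<chi> x\<close>.\<close>

lemma graded_components_independent:
  assumes "finite C" "C \<subseteq> carrier (character_group n)"
    and g: "\<And>\<chi>. \<chi> \<in> C \<Longrightarrow> g \<chi> \<in> graded_component n m X \<phi> \<chi>"
    and "(\<Sum>\<chi>\<in>C. g \<chi>) = 0" "\<chi> \<in> C"
  shows "g \<chi> = 0"
proof
  fix x
  show "g \<chi> x = 0 x"
  proof (cases "x \<in> X")
    case True
    have "g \<chi> x = 0"
    proof (rule torus_characters_independent[OF assms(1,2) _ assms(5), of "\<lambda>\<chi>. g \<chi> x"])
      fix t :: "nat \<Rightarrow> 'k" assume t: "t \<in> carrier (torus n)"
      have "(\<Sum>\<chi>\<in>C. g \<chi> x * \<chi> t) = (\<Sum>\<chi>\<in>C. g \<chi> (\<phi> t x))"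
        using graded_componentD(2)[OF g t True] by (intro sum.cong) auto
      also have "\<dots> = 0"
        using fun_cong[OF assms(4), of "\<phi> t x"] by (simp add: sum_fun_apply)
      finally show "(\<Sum>\<chi>\<in>C. g \<chi> x * \<chi> t) = 0" .
    qed
    then show ?thesis by simp
  next
    case False
    then show ?thesis
      using regular_function_outside[OF graded_componentD(1)[OF g[OF assms(5)]]] by simp
  qed
qed

text \<open>A semi-invariant is determined by its value at one point of the open orbit, since the
  orbit is dense. Subtracting a suitable multiple of \<open>f\<close> from \<open>g\<close> makes
  this value zero.\<close>

lemma graded_component_proportional:
  assumes f: "f \<in> graded_component n m X \<phi> \<chi>" and g: "g \<in> graded_component n m X \<phi> \<chi>" and "f \<noteq> 0"
  shows "\<exists>c. g = (\<lambda>_. c) * f"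
proof -
  interpret A: group_action "torus n" X \<phi> by (rule action)
  obtain x\<^sub>0 Z where x\<^sub>0: "x\<^sub>0 \<in> X" and Z: "zariski_closed m Z" "orbit (torus n) \<phi> x\<^sub>0 = X - Z"
    using toric by (auto simp: affine_toric_variety_def open_in_variety_def)
  have not: "\<not> X \<subseteq> Z"
    using A.orbit_refl[OF x\<^sub>0] Z(2) by blast
  have orbit_zero: "h = 0" if h: "h \<in> graded_component n m X \<phi> \<chi>" "h x\<^sub>0 = 0" for h
  proof -
    have "h x = 0" if "x \<in> X" "x \<notin> Z" for x
    proof -
      have "x \<in> orbit (torus n) \<phi> x\<^sub>0" using that Z(2) by blast
      then obtain t where "t \<in> carrier (torus n)" "x = \<phi> t x\<^sub>0"
        by (auto simp: orbit_def)
      then show ?thesis using graded_componentD(2)[OF h(1)] x\<^sub>0 h(2) by simp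
    qed
    then show ?thesis
      using irreducible_subset_zeros[OF irreducible Z(1) graded_componentD(1)[OF h(1)]] not by blast
  qed
  have f0: "f x\<^sub>0 \<noteq> 0" using orbit_zero[OF f] \<open>f \<noteq> 0\<close> by blast
  define c where "c = g x\<^sub>0 / f x\<^sub>0"
  define h where "h = g + (\<lambda>_. - c) * f"
  have "h \<in> graded_component n m X \<phi> \<chi>"
    using f g regular_functions_add[OF _ regular_functions_scale, of g m X f "- c"]
    by (auto simp: graded_component_def h_def right_diff_distrib)
  moreover have "h x\<^sub>0 = 0" using f0 by (simp add: h_def c_def)
  ultimately have "h = 0" by (rule orbit_zero)
  then have "g = (\<lambda>_. c) * f"
    by (auto simp: h_def fun_eq_iff)
  then show ?thesis by blast
qed

lemma scalar_domain_regular_functions: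
  "scalar_domain (carrier K_X) \<one>\<^bsub>K_X\<^esub> (\<lambda>c _. c)"
  unfolding regular_functions_simps
proof
  show "(\<lambda>x. if x \<in> X then 1 else 0) \<in> carrier K_X" by (rule regular_functions_const)
  show "(\<lambda>x. if x \<in> X then 1 else 0) * b = b" if "b \<in> carrier K_X" for b
    using regular_function_outside[OF that] by (auto simp: fun_eq_iff)
  show "(\<lambda>x. if x \<in> X then 1 else (0::'k)) \<noteq> 0"
    using irreducible by (auto simp: irreducible_affine_variety_def fun_eq_iff)
  show "a = 0 \<or> b = 0" if "a \<in> carrier K_X" "b \<in> carrier K_X" "a * b = 0" for a b
    by (rule regular_functions_no_zero_divisors[OF irreducible that])
qed (auto intro: regular_functions_add regular_functions_mult regular_functions_scale)

lemma graded_domain_regular_functions: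
  "graded_domain (carrier K_X) \<one>\<^bsub>K_X\<^esub> (\<lambda>c _. c) (character_group n) (graded_component n m X \<phi>)"
proof (rule graded_domain.intro[OF scalar_domain_regular_functions comm_group_character_group],
    rule graded_domain_axioms.intro)
  show "f \<in> carrier K_X" if "f \<in> graded_component n m X \<phi> \<chi>" for f \<chi>
    by (rule graded_componentD(1)[OF that])
  show "f + g \<in> graded_component n m X \<phi> \<chi>"
    if "f \<in> graded_component n m X \<phi> \<chi>" "g \<in> graded_component n m X \<phi> \<chi>" for f g \<chi>
    using that by (simp add: graded_component_def distrib_left regular_functions_add)
  show "(\<lambda>_. c) * f \<in> graded_component n m X \<phi> \<chi>"
    if "f \<in> graded_component n m X \<phi> \<chi>" for f c \<chi>
    using that by (simp add: graded_component_def regular_functions_scale)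
  show "f * g \<in> graded_component n m X \<phi> (\<chi> \<otimes>\<^bsub>character_group n\<^esub> \<psi>)"
    if "f \<in> graded_component n m X \<phi> \<chi>" "g \<in> graded_component n m X \<phi> \<psi>" for f g \<chi> \<psi>
    using that by (simp add: graded_component_def mult_character_group regular_functions_mult)
  show "0 \<in> graded_component n m X \<phi> \<chi>" for \<chi>
    using regular_functions_const[of X 0 m] by (simp add: graded_component_def zero_fun_def)
  show "\<one>\<^bsub>K_X\<^esub> \<in> graded_component n m X \<phi> \<one>\<^bsub>character_group n\<^esub>"
    using regular_functions_const[of X 1 m]
    by (simp add: regular_functions_simps graded_component_def one_character_group action_closed)
qed (fact graded_components_span graded_components_independent
    | rule graded_component_proportional, assumption+)+

section \<open>Makar-Limanov invariants of the coordinate ring\<close>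

interpretation graded_domain "carrier K_X" "\<one>\<^bsub>K_X\<^esub>" "\<lambda>c _. c" "character_group n"
  "graded_component n m X \<phi>"
  by (rule graded_domain_regular_functions)

lemma LND_iff_lnd: "D \<in> LND K_X \<longleftrightarrow> D \<in> extensional (carrier K_X) \<and> lnd D"
proof -
  have "D \<in> derivations K_X \<longleftrightarrow> D \<in> extensional (carrier K_X) \<and> derivation D"
    unfolding derivations_def derivation_def by (auto simp: regular_functions_simps PiE_def)
  moreover have "(\<exists>k>0. (D ^^ k) f = 0) \<longleftrightarrow> (\<exists>k. (D ^^ k) f = 0)" if "derivation D" for f
  proof
    assume "\<exists>k. (D ^^ k) f = 0"
    then obtain k where "(D ^^ k) f = 0" by blast
    then have "(D ^^ Suc k) f = 0"
      by (rule funpow_eq_zero_mono[OF that]) simp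
    then show "\<exists>k>0. (D ^^ k) f = 0" by blast
  qed blast
  ultimately show ?thesis
    unfolding LND_def lnd_def regular_functions_simps mem_Collect_eq by blast
qed

text \<open>\<open>homogeneous_part_of\<close> and \<open>twist\<close> need not be extensional;
  restriction puts such maps into \<open>LND\<close> and leaves their iterates on the carrier
  unchanged.\<close>

lemma lnd_restrict:
  assumes "lnd D"
  shows "lnd (restrict D (carrier K_X))"
proof -
  note der = lnd_derivation[OF assms]
  have "(restrict D (carrier K_X) ^^ k) f = (D ^^ k) f" if "f \<in> carrier K_X" for k f
    using that by (induction k) (auto simp: funpow_closed[OF der])
  moreover have "derivation (restrict D (carrier K_X))"
    using der unfolding derivation_def
    by (auto simp: add_closed mult_closed scale_closed)
  ultimately show ?thesis
    using assms by (auto simp: lnd_def)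
qed

lemma common_kernelI:
  assumes "f \<in> carrier K_X" "\<And>D. D \<in> \<D> \<Longrightarrow> D f = 0"
  shows "f \<in> common_kernel K_X \<D>"
  using assms by (auto simp: common_kernel_def a_kernel_def' regular_functions_simps)

lemma common_kernelD:
  assumes "f \<in> common_kernel K_X \<D>"
  shows "f \<in> carrier K_X" "D \<in> \<D> \<Longrightarrow> D f = 0"
  using assms by (auto simp: common_kernel_def a_kernel_def' regular_functions_simps)

lemma common_kernel_antimono: "\<D> \<subseteq> \<E> \<Longrightarrow> common_kernel K_X \<E> \<subseteq> common_kernel K_X \<D>"
  by (auto simp: common_kernel_def)

lemma LND_h_iff:
  "D \<in> LND_h n m X \<phi> \<longleftrightarrow> D \<in> LND K_X \<and> (\<exists>e\<in>carrier (character_group n). homogeneous e D)"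
  unfolding LND_h_def homogeneous_def by (auto simp: image_subset_iff)

lemma LND_h_restrict:
  assumes "lnd E" "e \<in> carrier (character_group n)" "homogeneous e E"
  shows "restrict E (carrier K_X) \<in> LND_h n m X \<phi>"
proof -
  have "homogeneous e (restrict E (carrier K_X))"
    using assms(3) comp_subset unfolding homogeneous_def by auto
  then show ?thesis
    using assms lnd_restrict by (auto simp: LND_h_iff LND_iff_lnd)
qed

text \<open>One inclusion is \<open>kernel_homogeneous_lnds\<close>, applied after restriction to
  the carrier; the other holds because \<open>LND_h\<close> is part of \<open>LND\<close>.\<close>

lemma makar_limanov_h_eq: "makar_limanov_h n m X \<phi> = makar_limanov K_X"
  unfolding makar_limanov_h_def makar_limanov_def
proof
  show "common_kernel K_X (LND_h n m X \<phi>) \<subseteq> common_kernel K_X (LND K_X)"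
  proof
    fix f assume f: "f \<in> common_kernel K_X (LND_h n m X \<phi>)"
    note fB = common_kernelD(1)[OF f]
    show "f \<in> common_kernel K_X (LND K_X)"
    proof (rule common_kernelI[OF fB])
      fix D assume "D \<in> LND K_X"
      then have D: "lnd D" by (simp add: LND_iff_lnd)
      show "D f = 0"
      proof (rule kernel_homogeneous_lnds[OF D fB])
        fix e E assume "e \<in> carrier (character_group n)" "lnd E" "homogeneous e E"
        then have "restrict E (carrier K_X) f = 0"
          by (intro common_kernelD(2)[OF f] LND_h_restrict)
        then show "E f = 0" by (simp only: restrict_apply' fB)
      qed
    qed
  qed
  show "common_kernel K_X (LND K_X) \<subseteq> common_kernel K_X (LND_h n m X \<phi>)"
    by (rule common_kernel_antimono) (auto simp: LND_h_iff)
qed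

text \<open>The given slice feeds \<open>kernel_lnds_with_slice\<close> for one inclusion. The other
  follows from \<open>makar_limanov_h_eq\<close>, since \<open>LND_star\<close> is part of
  \<open>LND\<close>.\<close>

lemma makar_limanov_star_eq:
  assumes "LND_star K_X \<noteq> {}"
  shows "makar_limanov_star K_X = makar_limanov_h n m X \<phi>"
proof
  obtain D\<^sub>0 where "D\<^sub>0 \<in> LND_star K_X" using assms by auto
  then have D\<^sub>0': "(D\<^sub>0 \<in> extensional (carrier K_X) \<and> lnd D\<^sub>0) \<and>
      (\<exists>s\<in>carrier K_X. D\<^sub>0 s = \<one>\<^bsub>K_X\<^esub>)"
    unfolding LND_star_def LND_iff_lnd mem_Collect_eq .
  obtain s\<^sub>0 where s\<^sub>0: "s\<^sub>0 \<in> carrier K_X" "D\<^sub>0 s\<^sub>0 = \<one>\<^bsub>K_X\<^esub>"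
    using conjunct2[OF D\<^sub>0'] by (rule bexE)
  note D\<^sub>0 = conjunct2[OF conjunct1[OF D\<^sub>0']] s\<^sub>0
  show "makar_limanov_star K_X \<subseteq> makar_limanov_h n m X \<phi>"
    unfolding makar_limanov_star_def makar_limanov_h_def
  proof
    fix f assume f: "f \<in> common_kernel K_X (LND_star K_X)"
    note fB = common_kernelD(1)[OF f]
    show "f \<in> common_kernel K_X (LND_h n m X \<phi>)"
    proof (rule common_kernelI[OF fB])
      fix D assume "D \<in> LND_h n m X \<phi>"
      then obtain e where D: "lnd D" "e \<in> carrier (character_group n)" "homogeneous e D"
        by (auto simp: LND_h_iff LND_iff_lnd)
      show "D f = 0"
      proof (rule kernel_lnds_with_slice[where D\<^sub>0 = D\<^sub>0 and s\<^sub>0 = s\<^sub>0 and D = D, OF D\<^sub>0 fB _ D])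
        fix E s assume E: "lnd E" "s \<in> carrier K_X" "E s = \<one>\<^bsub>K_X\<^esub>"
        have "restrict E (carrier K_X) s = \<one>\<^bsub>K_X\<^esub>" using E(2,3) by simp
        then have "restrict E (carrier K_X) \<in> LND_star K_X"
          unfolding LND_star_def LND_iff_lnd mem_Collect_eq
          by (intro conjI bexI[of _ s] restrict_extensional lnd_restrict[OF E(1)] E(2))
        then have "restrict E (carrier K_X) f = 0" by (rule common_kernelD(2)[OF f])
        then show "E f = 0" by (simp only: restrict_apply' fB)
      qed
    qed
  qed
  show "makar_limanov_h n m X \<phi> \<subseteq> makar_limanov_star K_X"
    unfolding makar_limanov_h_eq makar_limanov_def makar_limanov_star_def
    unfolding LND_star_def by (rule common_kernel_antimono[OF Collect_subset])
qed

end

theorem theorem1p1: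
  fixes X :: "(nat \<Rightarrow> 'k::{alg_closed_field, field_char_0}) set"
    and \<phi> :: "(nat \<Rightarrow> 'k) \<Rightarrow> (nat \<Rightarrow> 'k) \<Rightarrow> (nat \<Rightarrow> 'k)"
    and n m :: nat
  assumes "affine_toric_variety n m X \<phi>"
  shows "makar_limanov_h n m X \<phi> = makar_limanov (regular_functions m X) \<and>
    (LND_star (regular_functions m X) \<noteq> {} \<longrightarrow>
      makar_limanov_h n m X \<phi> = makar_limanov (regular_functions m X) \<and>
      makar_limanov (regular_functions m X) = makar_limanov_star (regular_functions m X))"
  using makar_limanov_h_eq[OF assms] makar_limanov_star_eq[OF assms] by simp

end
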